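(* Let $(\mathcal{A},\varphi)$ be a tracial noncommutative probability space with universal enveloping traffic space $(\mathcal{B},\psi)$. For any $t\in\Delta(\mathcal{B})$ there exists $\mathbf{T}(t)\in\Delta_{\mathrm{tree}}(\mathcal{B})$ such that $\mathbf{T}(t)\equiv t\pmod\psi$.
   Context: $(\mathcal{A},\varphi)$: $\mathcal{A}$ a unital complex algebra, $\varphi$ a unital linear functional with $\varphi(ab)=\varphi(ba)$. Free cumulants $\kappa_n$ are determined by $\varphi(a_1\cdots a_n)=\sum_{\pi\in NC(n)}\prod_{B\in\pi}\kappa_{|B|}[(a_i)_{i\in B}]$. A graph monomial in $\mathcal{A}$ is a finite connected directed multigraph $(V,E,\mathrm{src},\mathrm{tgt})$ (loops, parallel edges allowed) with distinguished, not necessarily distinct, vertices $v_{\mathrm{in}},v_{\mathrm{out}}$ and edge labels $\gamma:E\to\mathcal{A}$, up to isomorphism. For $a\in\mathcal{A}$, $\iota(a)$ has two vertices and one edge from $v_{\mathrm{in}}$ to $v_{\mathrm{out}}$ labelled $a$. Substitution $Z_g(t_1,\dots,t_K)$, for a connected bi-rooted multidigraph $g$ with ordered edges $e_1,\dots,e_K$, replaces each $e_i$ by a copy of $t_i$, identifying $\mathrm{src}(e_i)$ with the input and $\mathrm{tgt}(e_i)$ with the output of $t_i$; the product $t_1t_2$ identifies the input of $t_1$ with the output of $t_2$ (the output of $t_1$ and input of $t_2$ become output and input). $\mathcal{B}=\mathcal{G}(\mathcal{A})$ is the span of graph monomials modulo the span of all $Z_g(\iota(a_1),\dots,\iota(a_K))-Z_g(P(\iota(b_1),\dots,\iota(b_n)),\iota(a_2),\dots)$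 (in any edge position) with $a_1=P(b_1,\dots,b_n)$, $P$ a noncommutative polynomial. A test graph is a finite connected directed multigraph with labels in $\mathcal{A}$; $T^\pi$ identifies vertices in the blocks of a partition $\pi$ of its vertex set. A cactus is a connected multigraph with every edge in exactly one simple cycle (loops and pairs of parallel edges count as cycles); cycles are pads; an oriented cactus has every pad a directed cycle. $\tau^0_\varphi[T]=\prod_{C\in\mathrm{Pads}(T)}\kappa_{n_C}[\gamma(e_1),\dots,\gamma(e_{n_C})]$ if $T$ is an oriented cactus (edges of $C$ listed with $\mathrm{src}(e_i)=\mathrm{tgt}(e_{i+1})$, indices mod $n_C$), else $0$; $\tau_\varphi[T]=\sum_\pi\tau^0_\varphi[T^\pi]$ over all partitions of the vertex set. $\psi(t)=\tau_\varphi[\tilde\Delta(t)]$, where $\tilde\Delta(t)$ identifies input and output and forgets the roots, extended linearly; this is well defined on $\mathcal{B}$. $\Delta(\mathcal{B})$: span of classes of graph monomials with $v_{\mathrm{in}}=v_{\mathrm{out}}$. $\Delta_{\mathrm{tree}}(\mathcal{B})$: span of classes of graph monomials with $v_{\mathrm{in}}=v_{\mathrm{out}}$ whose underlying undirected multigraph is a tree. For $s,t\in\mathcal{B}$, $s\equiv t\pmod\psi$ means $\psi((s-t)u)=0$ for all $u\in\mathcal{B}$. *)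

theory Defs
  imports Complex_Main "HOL-Library.Disjoint_Sets"
begin

section \<open>The tracial noncommutative probability space\<close>

text \<open>A unital complex algebra: a ring with unit together with a complex scalar
multiplication making it a complex vector space, bilinear w.r.t. the product.\<close>
definition complex_algebra :: "(complex \<Rightarrow> 'a::ring_1 \<Rightarrow> 'a) \<Rightarrow> bool" where
  "complex_algebra smul \<longleftrightarrow> module smul \<and>
     (\<forall>c a b. smul c (a * b) = smul c a * b \<and> smul c (a * b) = a * smul c b)"

definition noncrossing :: "nat set set \<Rightarrow> bool" where
  "noncrossing \<pi> \<longleftrightarrow> (\<forall>B\<in>\<pi>. \<forall>B'\<in>\<pi>. B \<noteq> B' \<longrightarrow>
     \<not> (\<exists>a b c d. a < b \<and> b < c \<and> c < d \<and> a \<in> B \<and> c \<in> B \<and> b \<in> B' \<and> d \<in> B'))"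

text \<open>Non-crossing partitions of \<open>{0..<n}\<close>.\<close>
definition NC :: "nat \<Rightarrow> nat set set set" where
  "NC n = {\<pi>. partition_on {..<n} \<pi> \<and> noncrossing \<pi>}"

text \<open>\<open>\<kappa>\<close> is the family of free cumulants of \<open>\<phi>\<close> (given as a function on lists
  \<open>[a_1,...,a_n]\<close>): the moment-cumulant formula holds for all tuples.\<close>
definition free_cumulants :: "('a::ring_1 \<Rightarrow> complex) \<Rightarrow> ('a list \<Rightarrow> complex) \<Rightarrow> bool" where
  "free_cumulants \<phi> \<kappa> \<longleftrightarrow>
     (\<forall>as. \<phi> (prod_list as) = (\<Sum>\<pi>\<in>NC (length as). \<Prod>B\<in>\<pi>. \<kappa> (nths as B)))"

section \<open>Finite directed multigraphs with labelled edges\<close>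

text \<open>A (test) graph is a vertex set \<open>V\<close> and a list of edges \<open>(src, tgt, label)\<close>;
  edges are identified by their position in the list, so parallel edges and loops
  are allowed.\<close>

definition esrc :: "'v \<times> 'v \<times> 'a \<Rightarrow> 'v" where "esrc e = fst e"
definition etgt :: "'v \<times> 'v \<times> 'a \<Rightarrow> 'v" where "etgt e = fst (snd e)"
definition elab :: "'v \<times> 'v \<times> 'a \<Rightarrow> 'a" where "elab e = snd (snd e)"

definition is_mgraph :: "'v set \<Rightarrow> ('v \<times> 'v \<times> 'a) list \<Rightarrow> bool" where
  "is_mgraph V E \<longleftrightarrow> finite V \<and> V \<noteq> {} \<and> (\<forall>e\<in>set E. esrc e \<in> V \<and> etgt e \<in> V)"

definition urel :: "('v \<times> 'v \<times> 'a) list \<Rightarrow> ('v \<times> 'v) set" where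
  "urel E = {(x, y). \<exists>e\<in>set E. (esrc e = x \<and> etgt e = y) \<or> (esrc e = y \<and> etgt e = x)}"

definition connected_mg :: "'v set \<Rightarrow> ('v \<times> 'v \<times> 'a) list \<Rightarrow> bool" where
  "connected_mg V E \<longleftrightarrow> is_mgraph V E \<and> (\<forall>x\<in>V. \<forall>y\<in>V. (x, y) \<in> (urel E)\<^sup>*)"

definition joins :: "'v \<times> 'v \<times> 'a \<Rightarrow> 'v \<Rightarrow> 'v \<Rightarrow> bool" where
  "joins e u w \<longleftrightarrow> (esrc e = u \<and> etgt e = w) \<or> (esrc e = w \<and> etgt e = u)"

text \<open>\<open>C\<close> (a set of edge indices) is the edge set of a simple cycle of the
  underlying undirected multigraph: a cyclic sequence of distinct vertices
  \<open>v_0,...,v_{k-1}\<close> and distinct edges \<open>e_0,...,e_{k-1}\<close>, \<open>k \<ge> 1\<close>, with \<open>e_i\<close> joining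
  \<open>v_i\<close> and \<open>v_{i+1 mod k}\<close> (so loops and pairs of parallel edges are cycles).\<close>
definition is_scycle :: "('v \<times> 'v \<times> 'a) list \<Rightarrow> nat set \<Rightarrow> bool" where
  "is_scycle E C \<longleftrightarrow> (\<exists>vs es. es \<noteq> [] \<and> length vs = length es \<and> distinct vs \<and> distinct es
     \<and> set es = C \<and> (\<forall>i<length es. es ! i < length E
        \<and> joins (E ! (es ! i)) (vs ! i) (vs ! ((i + 1) mod length es))))"

definition pads :: "('v \<times> 'v \<times> 'a) list \<Rightarrow> nat set set" where
  "pads E = {C. is_scycle E C}"

definition is_cactus :: "'v set \<Rightarrow> ('v \<times> 'v \<times> 'a) list \<Rightarrow> bool" where
  "is_cactus V E \<longleftrightarrow> connected_mg V E \<and> (\<forall>e<length E. \<exists>!C. is_scycle E C \<and> e \<in> C)"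

definition is_tree :: "'v set \<Rightarrow> ('v \<times> 'v \<times> 'a) list \<Rightarrow> bool" where
  "is_tree V E \<longleftrightarrow> connected_mg V E \<and> \<not> (\<exists>C. is_scycle E C)"

text \<open>A listing \<open>e_1,...,e_n\<close> of distinct edges with \<open>src(e_i) = tgt(e_{i+1})\<close>
  (indices mod \<open>n\<close>), i.e. a directed closed trail.\<close>
definition is_dcycle_list :: "('v \<times> 'v \<times> 'a) list \<Rightarrow> nat list \<Rightarrow> bool" where
  "is_dcycle_list E es \<longleftrightarrow> es \<noteq> [] \<and> distinct es \<and> (\<forall>i<length es. es ! i < length E \<and>
     esrc (E ! (es ! i)) = etgt (E ! (es ! ((i + 1) mod length es))))"

definition oriented_cactus :: "'v set \<Rightarrow> ('v \<times> 'v \<times> 'a) list \<Rightarrow> bool" where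
  "oriented_cactus V E \<longleftrightarrow> is_cactus V E \<and>
     (\<forall>C\<in>pads E. \<exists>es. is_dcycle_list E es \<and> set es = C)"

definition tau0 :: "('a list \<Rightarrow> complex) \<Rightarrow> 'v set \<Rightarrow> ('v \<times> 'v \<times> 'a) list \<Rightarrow> complex" where
  "tau0 \<kappa> V E = (if oriented_cactus V E then
     (\<Prod>C\<in>pads E. \<kappa> (map (\<lambda>i. elab (E ! i)) (SOME es. is_dcycle_list E es \<and> set es = C)))
   else 0)"

definition blk :: "'v set set \<Rightarrow> 'v \<Rightarrow> 'v set" where
  "blk \<pi> x = (THE B. B \<in> \<pi> \<and> x \<in> B)"

text \<open>The edges of \<open>T^\<pi>\<close> (its vertex set is \<open>\<pi>\<close>).\<close>
definition quot_edges :: "'v set set \<Rightarrow> ('v \<times> 'v \<times> 'a) list \<Rightarrow> ('v set \<times> 'v set \<times> 'a) list" where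
  "quot_edges \<pi> E = map (\<lambda>(x, y, a). (blk \<pi> x, blk \<pi> y, a)) E"

definition tau :: "('a list \<Rightarrow> complex) \<Rightarrow> 'v set \<Rightarrow> ('v \<times> 'v \<times> 'a) list \<Rightarrow> complex" where
  "tau \<kappa> V E = (\<Sum>\<pi>\<in>{\<pi>. partition_on V \<pi>}. tau0 \<kappa> \<pi> (quot_edges \<pi> E))"

section \<open>Graph monomials and the free span of graph monomials\<close>

record 'a gmon =
  gV :: "nat set"
  gE :: "(nat \<times> nat \<times> 'a) list"
  gin :: nat
  gout :: nat

definition wf_gm :: "'a gmon \<Rightarrow> bool" where
  "wf_gm g \<longleftrightarrow> connected_mg (gV g) (gE g) \<and> gin g \<in> gV g \<and> gout g \<in> gV g"

text \<open>Product of graph monomials: the input of \<open>g\<close> is identified with the output of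
  \<open>h\<close> (the vertices of \<open>h\<close> are first renamed to be fresh).\<close>
definition gmul :: "'a gmon \<Rightarrow> 'a gmon \<Rightarrow> 'a gmon" where
  "gmul g h = (let s = Suc (Max (insert 0 (gV g)));
                   f = (\<lambda>v. if v = gout h then gin g else v + s) in
     \<lparr> gV = gV g \<union> f ` gV h,
       gE = gE g @ map (\<lambda>(x, y, a). (f x, f y, a)) (gE h),
       gin = f (gin h), gout = gout g \<rparr>)"

text \<open>\<open>\<Delta>~(g)\<close>: identify input and output, forget the roots.\<close>
definition close_map :: "'a gmon \<Rightarrow> nat \<Rightarrow> nat" where
  "close_map g v = (if v = gout g then gin g else v)"

definition psi_gm :: "('a list \<Rightarrow> complex) \<Rightarrow> 'a gmon \<Rightarrow> complex" where
  "psi_gm \<kappa> g = tau \<kappa> (close_map g ` gV g)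
                    (map (\<lambda>(x, y, a). (close_map g x, close_map g y, a)) (gE g))"

text \<open>Elements of the span of graph monomials, as finite formal linear combinations.\<close>
type_synonym 'a gcomb = "(complex \<times> 'a gmon) list"

definition psi :: "('a list \<Rightarrow> complex) \<Rightarrow> 'a gcomb \<Rightarrow> complex" where
  "psi \<kappa> x = (\<Sum>(c, g)\<leftarrow>x. c * psi_gm \<kappa> g)"

definition cmul :: "'a gcomb \<Rightarrow> 'a gcomb \<Rightarrow> 'a gcomb" where
  "cmul x y = [(c * d, gmul g h). (c, g) \<leftarrow> x, (d, h) \<leftarrow> y]"

definition cdiff :: "'a gcomb \<Rightarrow> 'a gcomb \<Rightarrow> 'a gcomb" where
  "cdiff x y = x @ map (\<lambda>(c, g). (- c, g)) y"

definition B_span :: "'a gcomb set" where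
  "B_span = {x. \<forall>(c, g)\<in>set x. wf_gm g}"

definition Delta_span :: "'a gcomb set" where
  "Delta_span = {x. \<forall>(c, g)\<in>set x. wf_gm g \<and> gin g = gout g}"

definition Delta_tree_span :: "'a gcomb set" where
  "Delta_tree_span = {x. \<forall>(c, g)\<in>set x. wf_gm g \<and> gin g = gout g \<and> is_tree (gV g) (gE g)}"

text \<open>\<open>s \<equiv> t (mod \<psi>)\<close>.\<close>
definition equiv_mod_psi :: "('a list \<Rightarrow> complex) \<Rightarrow> 'a gcomb \<Rightarrow> 'a gcomb \<Rightarrow> bool" where
  "equiv_mod_psi \<kappa> s t \<longleftrightarrow> (\<forall>u\<in>B_span. psi \<kappa> (cmul (cdiff s t) u) = 0)"

end

theory Submission
  imports Defs
begin

text \<open>Write \<open>F\<^sub>t(u)\<close> for \<open>\<psi>(t u)\<close> and \<open>G\<^sub>t(u)\<close> for the part of the defining sum over vertex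
  partitions that identify no two vertices of \<open>t\<close>; then \<open>F\<^sub>t\<close> is the sum of \<open>G\<^bsub>t/\<rho>\<^esub>\<close> over all
  partitions \<open>\<rho>\<close> of the vertices of \<open>t\<close>. If \<open>t\<close> contains a cycle, that cycle is a pad of every cactus
  contributing to \<open>G\<^sub>t\<close>, and distinct vertices of a pad lie in different components once its edges are
  deleted. Multiplicativity at the cut vertex then gives \<open>G\<^sub>t = c G\<^bsub>t'\<^esub>\<close>, where \<open>t'\<close> is the component of
  the root, which has fewer edges. If \<open>t\<close> is a tree, \<open>G\<^sub>t\<close> is \<open>F\<^sub>t\<close> minus the terms \<open>G\<^bsub>t/\<rho>\<^esub>\<close> with \<open>\<rho>\<close>
  nontrivial, which have fewer vertices. By induction every \<open>G\<^sub>t\<close>, hence every \<open>F\<^sub>t\<close>, is a combination of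
  functionals \<open>F\<^sub>T\<close> with \<open>T\<close> a tree.\<close>

section \<open>Cyclic invariance of free cumulants\<close>

text \<open>A pad has no first edge, and \<open>tau0\<close> picks one of its cyclic listings
  arbitrarily. Weights are isomorphism invariant because the cumulants of a trace are cyclically
  invariant, which is why that fact precedes the graph theory. The obstacle in the cut is the sum
  over partitions: a block may join vertices of \<open>u\<close> to any vertex of \<open>t\<close>,
  so a priori \<open>u\<close> is attached to \<open>t\<close> everywhere and not only at the root.
  Pad separation excludes this. In a term of nonzero weight no vertex outside the root component is
  merged with anything, since that would link two vertices of the pad away from the pad. The cut-off
  part is therefore never quotiented, and \<open>c\<close> is its own cactus weight, independent of
  \<open>u\<close>. If the root component already contains two vertices of the cycle, every term
  vanishes and \<open>c\<close> is 0. Arguing with functionals of \<open>u\<close> instead of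
  elements matches congruence modulo \<psi>, which compares exactly these functionals.\<close>

lemma nths_cong_set:
  assumes "\<And>i. i < length xs \<Longrightarrow> i \<in> A \<longleftrightarrow> i \<in> B"
  shows "nths xs A = nths xs B"
proof -
  have "\<And>p. p \<in> set (zip xs [0..<length xs]) \<Longrightarrow> snd p < length xs"
    by (auto simp: set_zip)
  then show ?thesis
    unfolding nths_def using assms by (metis (mono_tags, lifting) filter_cong)
qed

text \<open>This is where \<open>rotate1\<close> sends position \<open>i\<close> of a list of length
  \<open>n\<close>; it rotates the points on which the partitions live.\<close>

definition shift_down :: "nat \<Rightarrow> nat \<Rightarrow> nat" where
  "shift_down n i = (if i = 0 then n - 1 else i - 1)"

lemma inj_shift_down: "inj_on (shift_down n) {..<n}"
  by (auto simp: inj_on_def shift_down_def split: if_splits)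

lemma shift_down_image: "shift_down n ` {..<n} = {..<n}"
  by (rule endo_inj_surj) (auto simp: inj_shift_down, auto simp: shift_down_def)

lemma finite_NC: "finite (NC n)"
  by (rule finite_subset[of _ "Pow (Pow {..<n})"]) (auto simp: NC_def partition_on_def)

text \<open>Being noncrossing depends only on the cyclic order of the points, so a rotation
  preserves it. The proof pulls a crossing of the rotated partition back to a crossing of the
  original one.\<close>

lemma shift_down_NC:
  assumes "\<pi> \<in> NC n"
  shows "image (shift_down n) ` \<pi> \<in> NC n"
proof -
  have p: "partition_on {..<n} \<pi>" and nc: "noncrossing \<pi>" using assms by (auto simp: NC_def)
  have sub: "\<And>B x. B \<in> \<pi> \<Longrightarrow> x \<in> B \<Longrightarrow> x < n" using p by (auto simp: partition_on_def)
  have 1: "partition_on {..<n} (image (shift_down n) ` \<pi>)"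
  proof -
    have "{} \<notin> image (shift_down n) ` \<pi>" using p by (auto simp: partition_on_def)
    then show ?thesis
      using partition_on_inj_image[OF p inj_shift_down[of n]] by (simp add: shift_down_image)
  qed
  have up: "(if x = n - 1 then 0 else Suc x) \<in> B" if xB: "x \<in> shift_down n ` B" "B \<in> \<pi>" for x B
  proof -
    obtain y where "x = shift_down n y" "y \<in> B" "y < n" using xB sub by auto
    then show ?thesis by (cases y) (auto simp: shift_down_def)
  qed
  have "noncrossing (image (shift_down n) ` \<pi>)"
    unfolding noncrossing_def
  proof (intro ballI impI notI)
    fix C C' assume C: "C \<in> image (shift_down n) ` \<pi>" "C' \<in> image (shift_down n) ` \<pi>" "C \<noteq> C'"
      and "\<exists>a b c d. a < b \<and> b < c \<and> c < d \<and> a \<in> C \<and> c \<in> C \<and> b \<in> C' \<and> d \<in> C'"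
    then obtain a b c d where abcd: "a < b" "b < c" "c < d" "a \<in> C" "c \<in> C" "b \<in> C'" "d \<in> C'"
      by blast
    obtain B B' where BB: "C = shift_down n ` B" "C' = shift_down n ` B'" "B \<in> \<pi>" "B' \<in> \<pi>"
      using C by auto
    note h = C(3) abcd BB
    have "d \<in> shift_down n ` B'" using h(8,10) by simp
    moreover have "B' \<subseteq> {..<n}" using sub[OF h(12)] by auto
    ultimately have "d \<in> shift_down n ` {..<n}" by (rule rev_subsetD[OF _ image_mono])
    then have dn: "d < n" by (simp add: shift_down_image)
    \<comment> \<open>Only the largest point \<open>d\<close> can come from the wrap-around. If it
      does, its preimage is 0, and \<open>0 < Suc a < Suc b < Suc c\<close> is again a crossing,
      with the roles of \<open>B\<close> and \<open>B'\<close> exchanged.\<close>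
    have "a \<noteq> n - 1" "b \<noteq> n - 1" "c \<noteq> n - 1" using h(2-4) dn by auto
    then have *: "Suc a \<in> B" "Suc c \<in> B" "Suc b \<in> B'"
      using up[of a B] up[of c B] up[of b B'] h(5-12) by simp_all
    have d: "(if d = n - 1 then 0 else Suc d) \<in> B'" using up[of d B'] h(8,10,12) by simp
    have "B \<noteq> B'" using h(1,9,10) by blast
    with nc h(11,12) have
      1: "\<And>x y z w. x < y \<Longrightarrow> y < z \<Longrightarrow> z < w \<Longrightarrow> x \<in> B \<Longrightarrow> z \<in> B \<Longrightarrow> y \<in> B' \<Longrightarrow> w \<notin> B'"
      and 2: "\<And>x y z w. x < y \<Longrightarrow> y < z \<Longrightarrow> z < w \<Longrightarrow> x \<in> B' \<Longrightarrow> z \<in> B' \<Longrightarrow> y \<in> B \<Longrightarrow> w \<notin> B"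
      unfolding noncrossing_def by metis+
    show False
      using 1[of "Suc a" "Suc b" "Suc c" "Suc d"] 2[of 0 "Suc a" "Suc b" "Suc c"] * d h(2-4)
      by (cases "d = n - 1") auto
  qed
  with 1 show ?thesis by (simp add: NC_def)
qed

lemma bij_shift_down_NC: "bij_betw (\<lambda>\<pi>. image (shift_down n) ` \<pi>) (NC n) (NC n)"
proof -
  have "inj_on (\<lambda>\<pi>. image (shift_down n) ` \<pi>) (Pow (Pow {..<n}))"
    by (intro inj_on_image_Pow inj_shift_down)
  then have "inj_on (\<lambda>\<pi>. image (shift_down n) ` \<pi>) (NC n)"
    by (rule inj_on_subset) (auto simp: NC_def partition_on_def)
  then show ?thesis
    unfolding bij_betw_def using finite_NC shift_down_NC
    by (metis endo_inj_surj image_subsetI)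
qed

text \<open>Rotation changes the internal order of a block only if the block contains position 0,
  whose entry moves from the front to the end.\<close>

lemma nths_rotate1:
  assumes "B \<subseteq> {..<length as}"
  shows "nths (rotate1 as) (shift_down (length as) ` B) =
    (if 0 \<in> B then rotate1 (nths as B) else nths as B)"
proof (cases as)
  case Nil
  then show ?thesis using assms by auto
next
  case (Cons a bs)
  have 1: "nths bs (shift_down (length as) ` B) = nths bs {j. Suc j \<in> B}"
    using assms Cons by (intro nths_cong_set) (force simp: shift_down_def image_iff split: if_splits)
  have 2: "length bs \<in> shift_down (length as) ` B \<longleftrightarrow> 0 \<in> B"
    using assms Cons by (force simp: shift_down_def image_iff split: if_splits)
  show ?thesis using 2 unfolding Cons by (simp add: nths_append nths_Cons 1[unfolded Cons, simplified])
qed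

text \<open>The moments of \<open>as\<close> and of \<open>rotate1 as\<close> agree by traciality.
  In their moment-cumulant expansions the rotation of partitions matches all terms except the
  one-block partition: every other partition has only shorter blocks, to which the induction
  hypothesis applies. What remains is the equality of the two top cumulants.\<close>

lemma cumulant_rotate1:
  assumes tr: "\<forall>a b. \<phi> (a * b) = \<phi> (b * a)" and fc: "free_cumulants \<phi> \<kappa>"
  shows "\<kappa> (rotate1 as) = \<kappa> as"
proof (induction as rule: length_induct)
  case (1 as)
  show ?case
  proof (cases as)
    case Nil then show ?thesis by simp
  next
    case (Cons a bs)
    let ?n = "length as" and ?sh = "\<lambda>\<pi>. image (shift_down (length as)) ` \<pi>"
    let ?f = "\<lambda>xs \<pi>. \<Prod>B\<in>\<pi>. \<kappa> (nths xs B)"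
    have n0: "?n > 0" using Cons by simp
    have top: "{{..<?n}} \<in> NC ?n"
      using n0 by (auto simp: NC_def noncrossing_def intro: partition_on_space)
    have shtop: "?sh {{..<?n}} = {{..<?n}}" by (simp add: shift_down_image)
    have "(\<Sum>\<pi>\<in>NC ?n. ?f as \<pi>) = \<phi> (prod_list as)"
      using fc by (simp add: free_cumulants_def)
    also have "\<dots> = \<phi> (prod_list (rotate1 as))" using tr Cons by simp
    also have "\<dots> = (\<Sum>\<pi>\<in>NC ?n. ?f (rotate1 as) \<pi>)"
      using fc unfolding free_cumulants_def by simp
    also have "\<dots> = (\<Sum>\<pi>\<in>NC ?n. ?f (rotate1 as) (?sh \<pi>))"
      by (rule sum.reindex_bij_betw[OF bij_shift_down_NC, symmetric])
    finally have eq: "(\<Sum>\<pi>\<in>NC ?n. ?f as \<pi>) = (\<Sum>\<pi>\<in>NC ?n. ?f (rotate1 as) (?sh \<pi>))" .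
    have "?f (rotate1 as) (?sh \<pi>) = ?f as \<pi>" if pi: "\<pi> \<in> NC ?n - {{{..<?n}}}" for \<pi>
    proof -
      have p: "partition_on {..<?n} \<pi>" using pi by (simp add: NC_def)
      have sub: "\<And>B. B \<in> \<pi> \<Longrightarrow> B \<subseteq> {..<?n}" using p by (auto simp: partition_on_def)
      have "inj_on (image (shift_down ?n)) \<pi>"
        by (rule inj_on_subset[OF inj_on_image_Pow[OF inj_shift_down]]) (use sub in auto)
      then have "?f (rotate1 as) (?sh \<pi>) = (\<Prod>B\<in>\<pi>. \<kappa> (nths (rotate1 as) (shift_down ?n ` B)))"
        by (simp add: prod.reindex)
      also have "\<dots> = ?f as \<pi>"
      proof (rule prod.cong)
        fix B assume B: "B \<in> \<pi>"
        have "B \<noteq> {..<?n}"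
        proof
          assume "B = {..<?n}"
          have "C = B" if "C \<in> \<pi>" for C
          proof (rule ccontr)
            assume "C \<noteq> B"
            then have "C \<inter> B = {}"
              using partition_onD2[OF p] that B by (simp add: disjoint_def)
            moreover have "C \<noteq> {}" using partition_onD3[OF p] that by auto
            ultimately show False using sub[OF that] \<open>B = {..<?n}\<close> by blast
          qed
          then have "\<pi> = {B}" using B by blast
          then show False using pi \<open>B = {..<?n}\<close> by auto
        qed
        then have "B \<subset> {..<?n}" using sub[OF B] by auto
        then have "card B < ?n" using psubset_card_mono[of "{..<?n}" B] by simp
        moreover have "{i. i < ?n \<and> i \<in> B} = B" using sub[OF B] by auto
        ultimately have "length (nths as B) < ?n" by (simp add: length_nths)
        then have "\<kappa> (rotate1 (nths as B)) = \<kappa> (nths as B)" using "1.IH" by simp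
        then show "\<kappa> (nths (rotate1 as) (shift_down ?n ` B)) = \<kappa> (nths as B)"
          using nths_rotate1[OF sub[OF B]] by simp
      qed simp
      finally show ?thesis .
    qed
    then have "(\<Sum>\<pi>\<in>NC ?n - {{{..<?n}}}. ?f (rotate1 as) (?sh \<pi>)) = (\<Sum>\<pi>\<in>NC ?n - {{{..<?n}}}. ?f as \<pi>)"
      by (intro sum.cong) auto
    then have "?f as {{..<?n}} = ?f (rotate1 as) (?sh {{..<?n}})"
      using eq unfolding sum.remove[OF finite_NC top] by simp
    then show ?thesis unfolding shtop by (simp add: nths_all)
  qed
qed

lemma cumulant_rotate:
  assumes "\<forall>a b. \<phi> (a * b) = \<phi> (b * a)" and "free_cumulants \<phi> \<kappa>"
  shows "\<kappa> (rotate k as) = \<kappa> as"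
  by (induction k) (simp_all add: cumulant_rotate1[OF assms])

section \<open>Circuits of a multigraph\<close>

text \<open>Edges are named by an index set and described by a map \<open>d\<close>, so that passing to a subgraph
  keeps the names and passing to a quotient only relabels the vertices.\<close>

definition ustep :: "('i \<Rightarrow> 'v \<times> 'v \<times> 'a) \<Rightarrow> 'i set \<Rightarrow> ('v \<times> 'v) set" where
  "ustep d C = {(x, y). \<exists>i\<in>C. joins (d i) x y}"

text \<open>Dependence in the graphic matroid; reflexivity of the closure makes loops dependent.
  Stated through reachability, it is easier to carry along subgraphs and vertex maps than a cyclic
  sequence of vertices and edges. A \<open>circuit\<close> is then a minimal dependent set, the edge
  set of a simple cycle.\<close>

definition dependent :: "('i \<Rightarrow> 'v \<times> 'v \<times> 'a) \<Rightarrow> 'i set \<Rightarrow> bool" where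
  "dependent d C \<longleftrightarrow> (\<exists>p\<in>C. (esrc (d p), etgt (d p)) \<in> (ustep d (C - {p}))\<^sup>*)"

definition circuit :: "('i \<Rightarrow> 'v \<times> 'v \<times> 'a) \<Rightarrow> 'i set \<Rightarrow> bool" where
  "circuit d C \<longleftrightarrow> dependent d C \<and> (\<forall>D. D \<subset> C \<longrightarrow> \<not> dependent d D)"

definition simple_cycle :: "('i \<Rightarrow> 'v \<times> 'v \<times> 'a) \<Rightarrow> 'v list \<Rightarrow> 'i list \<Rightarrow> bool" where
  "simple_cycle d vs es \<longleftrightarrow> es \<noteq> [] \<and> length vs = length es \<and> distinct vs \<and> distinct es \<and>
     (\<forall>i<length es. joins (d (es ! i)) (vs ! i) (vs ! ((i + 1) mod length es)))"

definition directed_cycle :: "('i \<Rightarrow> 'v \<times> 'v \<times> 'a) \<Rightarrow> 'i list \<Rightarrow> bool" where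
  "directed_cycle d es \<longleftrightarrow> es \<noteq> [] \<and> distinct es \<and>
     (\<forall>i<length es. esrc (d (es ! i)) = etgt (d (es ! ((i + 1) mod length es))))"

lemma joins_commute: "joins e x y \<longleftrightarrow> joins e y x"
  by (auto simp: joins_def)

lemma joins_self: "joins e (esrc e) (etgt e)"
  by (simp add: joins_def)

lemma joins_unique: "joins e x y \<Longrightarrow> joins e z w \<Longrightarrow> (z = x \<and> w = y) \<or> (z = y \<and> w = x)"
  by (auto simp: joins_def)

lemma ustep_mono: "C \<subseteq> D \<Longrightarrow> ustep d C \<subseteq> ustep d D"
  by (auto simp: ustep_def)

lemma conn_mono: "(x, y) \<in> (ustep d C)\<^sup>* \<Longrightarrow> C \<subseteq> D \<Longrightarrow> (x, y) \<in> (ustep d D)\<^sup>*"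
  using rtrancl_mono[OF ustep_mono] by blast

lemma conn_sym: "(x, y) \<in> (ustep d C)\<^sup>* \<Longrightarrow> (y, x) \<in> (ustep d C)\<^sup>*"
proof -
  have "sym (ustep d C)" by (auto simp: sym_def ustep_def joins_commute)
  then show "(x, y) \<in> (ustep d C)\<^sup>* \<Longrightarrow> (y, x) \<in> (ustep d C)\<^sup>*"
    by (meson symD sym_rtrancl)
qed

lemma conn_joins: "i \<in> C \<Longrightarrow> joins (d i) x y \<Longrightarrow> (x, y) \<in> (ustep d C)\<^sup>*"
  by (auto simp: ustep_def)

lemma conn_of_joins:
  assumes "joins (d p) x y"
  shows "(esrc (d p), etgt (d p)) \<in> (ustep d C)\<^sup>* \<longleftrightarrow> (x, y) \<in> (ustep d C)\<^sup>*"
  using assms conn_sym by (fastforce simp: joins_def)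

text \<open>A single step may be sent to a whole path, possibly the trivial one. This covers
  renamings, quotients and retractions onto a subgraph alike.\<close>

lemma conn_map:
  assumes "(x, y) \<in> (ustep d C)\<^sup>*"
    and "\<And>i u v. i \<in> C \<Longrightarrow> joins (d i) u v \<Longrightarrow> (f u, f v) \<in> (ustep d' D)\<^sup>*"
  shows "(f x, f y) \<in> (ustep d' D)\<^sup>*"
  using assms(1)
proof (induction rule: rtrancl_induct)
  case (step y z)
  then have "(f y, f z) \<in> (ustep d' D)\<^sup>*" using assms(2) by (auto simp: ustep_def)
  then show ?case using step.IH by simp
qed simp

lemma conn_invariant:
  assumes "(x, y) \<in> (ustep d C)\<^sup>*"
    and "\<And>i u v. i \<in> C \<Longrightarrow> joins (d i) u v \<Longrightarrow> u \<in> S \<Longrightarrow> v \<in> S" and "x \<in> S"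
  shows "y \<in> S"
  using assms(1)
proof (induction rule: rtrancl_induct)
  case (step y z)
  then show ?case using assms(2) by (auto simp: ustep_def)
qed (rule assms(3))

text \<open>A step is prepended to a simple path. If the new vertex already lies on the path, the
  part before it is dropped; otherwise the new edge is new as well, because both ends of an edge of
  the path lie on the path.\<close>

lemma conn_simple_path:
  assumes "(x, y) \<in> (ustep d D)\<^sup>*"
  shows "\<exists>vs es. length vs = Suc (length es) \<and> distinct vs \<and> distinct es \<and> set es \<subseteq> D \<and>
    vs ! 0 = x \<and> vs ! length es = y \<and> (\<forall>i<length es. joins (d (es ! i)) (vs ! i) (vs ! Suc i))"
  using assms
proof (induction rule: converse_rtrancl_induct)
  case base
  show ?case by (rule exI[of _ "[y]"], rule exI[of _ "[]"]) simp
next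
  case (step x z)
  then obtain vs es where *: "length vs = Suc (length es)" "distinct vs" "distinct es" "set es \<subseteq> D"
    "vs ! 0 = z" "vs ! length es = y" "\<And>i. i < length es \<Longrightarrow> joins (d (es ! i)) (vs ! i) (vs ! Suc i)"
    by blast
  obtain e where e: "e \<in> D" "joins (d e) x z" using step.hyps by (auto simp: ustep_def)
  show ?case
  proof (cases "x \<in> set vs")
    case True
    then obtain k where k: "k < length vs" "vs ! k = x" by (auto simp: in_set_conv_nth)
    show ?thesis
    proof (rule exI[of _ "drop k vs"], rule exI[of _ "drop k es"], intro conjI allI impI)
      show "set (drop k es) \<subseteq> D" using *(4) set_drop_subset[of k es] by blast
      fix i assume "i < length (drop k es)"
      then show "joins (d (drop k es ! i)) (drop k vs ! i) (drop k vs ! Suc i)"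
        using *(7)[of "k + i"] k *(1) by simp
    qed (use * k in simp_all)
  next
    case False
    have "e \<notin> set es"
    proof
      assume "e \<in> set es"
      then obtain i where i: "i < length es" "es ! i = e" by (auto simp: in_set_conv_nth)
      then have "x = vs ! i \<or> x = vs ! Suc i" using *(7)[OF i(1)] e(2) joins_unique by metis
      then show False using False i *(1) by (metis Suc_less_eq less_SucI nth_mem)
    qed
    then show ?thesis
      using False * e
      by (intro exI[of _ "x # vs"] exI[of _ "e # es"]) (auto simp: nth_Cons split: nat.splits)
  qed
qed

lemma simple_cycle_arc:
  assumes "simple_cycle d vs es" "i \<le> j" "j < length es"
  shows "(vs ! i, vs ! j) \<in> (ustep d ((!) es ` {i..<j}))\<^sup>*"
  using assms(2,3)
proof (induction j rule: dec_induct)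
  case (step j)
  have "joins (d (es ! j)) (vs ! j) (vs ! Suc j)"
    using assms(1) step.prems unfolding simple_cycle_def by (metis Suc_eq_plus1 Suc_lessD mod_less)
  then have "(vs ! j, vs ! Suc j) \<in> (ustep d ((!) es ` {i..<Suc j}))\<^sup>*"
    using step.hyps by (intro conn_joins[of "es ! j"]) auto
  moreover have "(vs ! i, vs ! j) \<in> (ustep d ((!) es ` {i..<Suc j}))\<^sup>*"
    by (rule conn_mono[OF step.IH]) (use step.prems in auto)
  ultimately show ?case by simp
qed simp

text \<open>The last edge of the cycle is bypassed by all the others. For minimality, suppose
  \<open>p\<close> is bypassed inside a proper subset, which omits some edge \<open>q\<close>:
  deleting \<open>p\<close> and \<open>q\<close> cuts the cycle into two arcs, and the ends of
  \<open>p\<close> lie on different ones.\<close>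

lemma simple_cycle_circuit:
  assumes c: "simple_cycle d vs es"
  shows "circuit d (set es)"
proof -
  let ?n = "length es"
  have n: "?n > 0" "length vs = ?n" "distinct vs" "distinct es"
    and jn: "\<And>i. i < ?n \<Longrightarrow> joins (d (es ! i)) (vs ! i) (vs ! ((i + 1) mod ?n))"
    using c by (auto simp: simple_cycle_def)
  have "dependent d (set es)"
    unfolding dependent_def
  proof (rule bexI)
    let ?p = "es ! (?n - 1)"
    show "?p \<in> set es" using n by simp
    have sub: "(!) es ` {0..<?n - 1} \<subseteq> set es - {?p}"
      using n by (auto simp: nth_eq_iff_index_eq)
    have "(vs ! 0, vs ! (?n - 1)) \<in> (ustep d (set es - {?p}))\<^sup>*"
      by (rule conn_mono[OF simple_cycle_arc[OF c, of 0 "?n - 1"] sub]) (use n in auto)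
    then show "(esrc (d ?p), etgt (d ?p)) \<in> (ustep d (set es - {?p}))\<^sup>*"
      using jn[of "?n - 1"] n conn_of_joins[of d ?p "vs ! 0" "vs ! (?n - 1)"] joins_commute
      by fastforce
  qed
  moreover have "\<not> dependent d D" if D: "D \<subset> set es" for D
  proof
    assume "dependent d D"
    then obtain p where p: "p \<in> D" "(esrc (d p), etgt (d p)) \<in> (ustep d (D - {p}))\<^sup>*"
      by (auto simp: dependent_def)
    obtain i where i: "i < ?n" "p = es ! i" using p D by (metis in_set_conv_nth psubsetD)
    obtain q where q: "q \<in> set es" "q \<notin> D" using D by auto
    obtain j where j: "j < ?n" "q = es ! j" using q by (metis in_set_conv_nth)
    have ij: "i \<noteq> j" using p q i j by auto
    \<comment> \<open>With edge \<open>k\<close> running from vertex \<open>k\<close> to vertex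
      \<open>k + 1\<close>, the set \<open>S\<close> is the arc strictly after the smaller and up to
      the larger of the two deleted positions. Edges \<open>i\<close> and \<open>j\<close> are the
      only ones that leave it.\<close>
    define S where "S = (!) vs ` {k. min i j < k \<and> k \<le> max i j}"
    have S: "vs ! k \<in> S \<longleftrightarrow> min i j < k \<and> k \<le> max i j" if "k < ?n" for k
      using that n i j unfolding S_def by (auto simp: nth_eq_iff_index_eq)
    have inv: "vs ! k \<in> S \<longleftrightarrow> vs ! ((k + 1) mod ?n) \<in> S" if "k < ?n" "k \<noteq> i" "k \<noteq> j" for k
    proof (cases "k + 1 = ?n")
      case True
      then show ?thesis using S[of k] S[of 0] that i j n by auto
    next
      case False
      then show ?thesis using S[of k] S[of "k + 1"] that i j n by auto
    qed
    have flip: "vs ! i \<in> S \<longleftrightarrow> vs ! ((i + 1) mod ?n) \<notin> S"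
    proof (cases "i + 1 = ?n")
      case True
      then show ?thesis using S[of i] S[of 0] i j ij n by auto
    next
      case False
      then show ?thesis using S[of i] S[of "i + 1"] i j ij n by auto
    qed
    have step: "v \<in> S" if "e \<in> D - {p}" "joins (d e) u v" "u \<in> S" for e u v
    proof -
      have "e \<in> set es" using that D by auto
      then obtain k where k: "k < ?n" "e = es ! k" by (metis in_set_conv_nth)
      have "k \<noteq> i" "k \<noteq> j" using that k i j q by auto
      then show ?thesis using inv[OF k(1)] jn[OF k(1)] k(2) that joins_unique by metis
    qed
    have "(vs ! i, vs ! ((i + 1) mod ?n)) \<in> (ustep d (D - {p}))\<^sup>*"
      using p(2) jn[OF i(1)] i(2) conn_of_joins by metis
    moreover have "b \<in> S" if "(a, b) \<in> (ustep d (D - {p}))\<^sup>*" "a \<in> S" for a b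
      by (rule conn_invariant[OF that(1) step that(2)])
    ultimately show False using conn_sym flip by metis
  qed
  ultimately show ?thesis by (auto simp: circuit_def)
qed

lemma simple_cycle_through:
  assumes "p \<notin> D" "(esrc (d p), etgt (d p)) \<in> (ustep d D)\<^sup>*"
  shows "\<exists>vs es. simple_cycle d vs es \<and> p \<in> set es \<and> set es \<subseteq> insert p D"
proof -
  obtain vs es where *: "length vs = Suc (length es)" "distinct vs" "distinct es" "set es \<subseteq> D"
    "vs ! 0 = esrc (d p)" "vs ! length es = etgt (d p)"
    "\<And>i. i < length es \<Longrightarrow> joins (d (es ! i)) (vs ! i) (vs ! Suc i)"
    using conn_simple_path[OF assms(2)] by blast
  have "simple_cycle d vs (es @ [p])"
    unfolding simple_cycle_def
  proof (intro conjI allI impI)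
    show "distinct (es @ [p])" using * assms by auto
    fix i assume "i < length (es @ [p])"
    then show "joins (d ((es @ [p]) ! i)) (vs ! i) (vs ! ((i + 1) mod length (es @ [p])))"
      using * joins_self[of "d p"] joins_commute[of "d p"]
      by (cases "i = length es") (auto simp: nth_append)
  qed (use * in auto)
  then show ?thesis using * by (intro exI[of _ vs] exI[of _ "es @ [p]"]) auto
qed

text \<open>The simple cycle through a bypassed edge of \<open>C\<close> runs inside
  \<open>C\<close> and is itself dependent, so minimality forces it to be all of
  \<open>C\<close>.\<close>

lemma circuit_simple_cycle:
  assumes "circuit d C"
  obtains vs es where "simple_cycle d vs es" "set es = C"
proof -
  obtain p where p: "p \<in> C" "(esrc (d p), etgt (d p)) \<in> (ustep d (C - {p}))\<^sup>*"
    using assms by (auto simp: circuit_def dependent_def)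
  obtain vs es where c: "simple_cycle d vs es" "set es \<subseteq> insert p (C - {p})"
    using simple_cycle_through[OF _ p(2)] by auto
  have "set es = C"
    using c p(1) simple_cycle_circuit[OF c(1)] assms unfolding circuit_def by blast
  then show ?thesis using that c by blast
qed

lemma is_scycle_iff_circuit:
  "is_scycle E C \<longleftrightarrow> C \<subseteq> {..<length E} \<and> circuit ((!) E) C"
proof
  assume "is_scycle E C"
  then obtain vs es where "simple_cycle ((!) E) vs es" "set es = C" "\<And>i. i < length es \<Longrightarrow> es ! i < length E"
    by (auto simp: is_scycle_def simple_cycle_def)
  then show "C \<subseteq> {..<length E} \<and> circuit ((!) E) C"
    using simple_cycle_circuit by (metis in_set_conv_nth lessThan_iff subsetI)
next
  assume C: "C \<subseteq> {..<length E} \<and> circuit ((!) E) C"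
  then obtain vs es where "simple_cycle ((!) E) vs es" "set es = C"
    using circuit_simple_cycle by blast
  then show "is_scycle E C"
    using C unfolding is_scycle_def simple_cycle_def by (metis lessThan_iff nth_mem subsetD)
qed

text \<open>A \<open>directed_cycle\<close> is only a closed trail and could revisit vertices. On a
  circuit there are as many vertices as edges and each vertex is the target of some edge, so targets
  are distinct; the source of an edge then determines the next edge, and only the starting point is
  free.\<close>

lemma directed_cycle_unique_up_to_rotation:
  assumes C: "circuit d C" and es: "directed_cycle d es" "set es = C"
    and es': "directed_cycle d es'" "set es' = C"
  shows "\<exists>k. es' = rotate k es"
proof -
  let ?n = "length es" and ?t = "\<lambda>i. etgt (d i)"
  have n: "?n > 0" "distinct es" "distinct es'" using es es' by (auto simp: directed_cycle_def)
  have len: "length es' = ?n" using es es' n by (metis distinct_card)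
  have nxt: "esrc (d (es ! i)) = ?t (es ! ((i + 1) mod ?n))" if "i < ?n" for i
    using es that by (auto simp: directed_cycle_def)
  have nxt': "esrc (d (es' ! i)) = ?t (es' ! ((i + 1) mod ?n))" if "i < ?n" for i
    using es' that len by (auto simp: directed_cycle_def)
  obtain vs fs where c: "simple_cycle d vs fs" "set fs = C" using circuit_simple_cycle[OF C] .
  have "set vs \<subseteq> ?t ` C"
  proof
    fix v assume "v \<in> set vs"
    then obtain i where i: "i < length fs" "v = vs ! i"
      using c by (metis in_set_conv_nth simple_cycle_def)
    then have "v = ?t (fs ! i) \<or> v = esrc (d (fs ! i))"
      using c by (auto simp: simple_cycle_def joins_def)
    moreover have "fs ! i \<in> C" using c i by auto
    moreover have "esrc (d e) \<in> ?t ` C" if e: "e \<in> C" for e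
    proof -
      obtain j where "j < ?n" "e = es ! j" using e es by (metis in_set_conv_nth)
      then show ?thesis using nxt[of j] es n by auto
    qed
    ultimately show "v \<in> ?t ` C" by blast
  qed
  moreover have "card (set vs) = card C"
    using c by (metis distinct_card simple_cycle_def)
  moreover have "finite C" using es by auto
  ultimately have "card (?t ` C) = card C"
    by (metis card_image_le card_mono finite_imageI le_antisym)
  then have inj: "inj_on ?t C" using \<open>finite C\<close> by (simp add: inj_on_iff_eq_card)
  obtain k where k: "k < ?n" "es' ! 0 = es ! k"
    using es es' n len by (metis in_set_conv_nth nth_mem)
  have "es' ! i = es ! ((k + i) mod ?n)" if "i < ?n" for i
    using that
  proof (induction i)
    case 0
    then show ?case using k by simp
  next
    case (Suc i)
    have "?t (es' ! Suc i) = esrc (d (es' ! i))" using nxt'[of i] Suc.prems by simp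
    also have "\<dots> = ?t (es ! ((k + Suc i) mod ?n))"
      using Suc nxt[of "(k + i) mod ?n"] n by (simp add: mod_Suc_eq)
    finally show ?case
      using inj es es' Suc.prems len n by (metis inj_on_def mod_less_divisor nth_mem)
  qed
  then have "es' = rotate k es"
    using len by (intro nth_equalityI) (auto simp: nth_rotate)
  then show ?thesis by blast
qed

text \<open>Leaving a pad through its complement and coming back elsewhere would create a second
  cycle through an edge of the pad.\<close>
lemma circuit_vertices_separated:
  assumes I: "P \<subseteq> I" and un: "\<And>e. e \<in> P \<Longrightarrow> \<exists>!C. C \<subseteq> I \<and> circuit d C \<and> e \<in> C"
    and P: "circuit d P" and p: "p \<in> P" "joins (d p) x x'" and q: "q \<in> P" "joins (d q) y y'"
    and "x \<noteq> y"
  shows "(x, y) \<notin> (ustep d (I - P))\<^sup>*"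
proof
  assume xy: "(x, y) \<in> (ustep d (I - P))\<^sup>*"
  obtain vs es where c: "simple_cycle d vs es" "set es = P" using circuit_simple_cycle[OF P] .
  let ?n = "length es"
  have n: "length vs = ?n" "?n > 0" "distinct es" using c by (auto simp: simple_cycle_def)
  have idx: "\<exists>i<?n. u = vs ! i" if e: "e \<in> P" "joins (d e) u u'" for e u u'
  proof -
    obtain i where i: "i < ?n" "e = es ! i" using e c by (metis in_set_conv_nth)
    then have "joins (d e) (vs ! i) (vs ! ((i + 1) mod ?n))" using c by (auto simp: simple_cycle_def)
    then have "u = vs ! i \<or> u = vs ! ((i + 1) mod ?n)" using e i(2) joins_unique by metis
    then show ?thesis using i n by (metis mod_less_divisor)
  qed
  obtain i j where "i < ?n" "x = vs ! i" "j < ?n" "y = vs ! j" using idx[OF p] idx[OF q] by blast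
  then obtain i j where ij: "i < j" "j < ?n" "(vs ! j, vs ! i) \<in> (ustep d (I - P))\<^sup>*"
    using xy conn_sym[OF xy] \<open>x \<noteq> y\<close> by (metis nat_neq_iff)
  let ?e = "es ! i"
  \<comment> \<open>The detour off the pad closes up the arc from position \<open>i\<close> to
    position \<open>j\<close>. The resulting cycle contains \<open>?e\<close> but cannot contain
    edge \<open>j\<close> of the pad, so it is a second cycle through \<open>?e\<close>.\<close>
  let ?D = "(!) es ` {Suc i..<j} \<union> (I - P)"
  have je: "joins (d ?e) (vs ! i) (vs ! Suc i)"
    using c ij unfolding simple_cycle_def
    by (metis Suc_eq_plus1 Suc_lessI less_trans mod_less not_less_iff_gr_or_eq)
  have eP: "?e \<in> P" "es ! j \<in> P" using c ij by auto
  have eD: "?e \<notin> ?D" using ij n eP by (auto simp: nth_eq_iff_index_eq)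
  have "(vs ! Suc i, vs ! j) \<in> (ustep d ?D)\<^sup>*"
    by (rule conn_mono[OF simple_cycle_arc[OF c(1)]]) (use ij in auto)
  moreover have "(vs ! j, vs ! i) \<in> (ustep d ?D)\<^sup>*" by (rule conn_mono[OF ij(3)]) auto
  ultimately have "(vs ! i, vs ! Suc i) \<in> (ustep d ?D)\<^sup>*" by (metis conn_sym rtrancl_trans)
  then have "(esrc (d ?e), etgt (d ?e)) \<in> (ustep d ?D)\<^sup>*" 
    using conn_of_joins[of d ?e, OF je] by simp
  then obtain ws fs where w: "simple_cycle d ws fs" "?e \<in> set fs" "set fs \<subseteq> insert ?e ?D"
    using simple_cycle_through[OF eD] by blast
  have "?D \<subseteq> I" using I c ij by auto
  then have "set fs \<subseteq> I" using w I eP by blast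
  then have "set fs = P" using un[OF eP(1)] simple_cycle_circuit[OF w(1)] w(2) P I eP by blast
  moreover have "es ! j \<notin> insert ?e ?D" using ij n eP by (auto simp: nth_eq_iff_index_eq)
  ultimately show False using w(3) eP by blast
qed

section \<open>Weights of oriented cacti\<close>

definition relabel :: "('v \<Rightarrow> 'w) \<Rightarrow> 'v \<times> 'v \<times> 'a \<Rightarrow> 'w \<times> 'w \<times> 'a" where
  "relabel f e = (f (esrc e), f (etgt e), elab e)"

definition edges_in :: "'v set \<Rightarrow> 'i set \<Rightarrow> ('i \<Rightarrow> 'v \<times> 'v \<times> 'a) \<Rightarrow> bool" where
  "edges_in V I d \<longleftrightarrow> (\<forall>i\<in>I. esrc (d i) \<in> V \<and> etgt (d i) \<in> V)"

definition connected_graph :: "'v set \<Rightarrow> 'i set \<Rightarrow> ('i \<Rightarrow> 'v \<times> 'v \<times> 'a) \<Rightarrow> bool" where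
  "connected_graph V I d \<longleftrightarrow> finite V \<and> V \<noteq> {} \<and> edges_in V I d \<and>
     (\<forall>x\<in>V. \<forall>y\<in>V. (x, y) \<in> (ustep d I)\<^sup>*)"

definition ocactus :: "'v set \<Rightarrow> 'i set \<Rightarrow> ('i \<Rightarrow> 'v \<times> 'v \<times> 'a) \<Rightarrow> bool" where
  "ocactus V I d \<longleftrightarrow> connected_graph V I d \<and>
     (\<forall>e\<in>I. \<exists>!C. C \<subseteq> I \<and> circuit d C \<and> e \<in> C) \<and>
     (\<forall>C. C \<subseteq> I \<and> circuit d C \<longrightarrow> (\<exists>es. directed_cycle d es \<and> set es = C))"

definition pad_weight :: "('a list \<Rightarrow> complex) \<Rightarrow> ('i \<Rightarrow> 'v \<times> 'v \<times> 'a) \<Rightarrow> 'i set \<Rightarrow> complex" where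
  "pad_weight \<kappa> d C = \<kappa> (map (\<lambda>i. elab (d i)) (SOME es. directed_cycle d es \<and> set es = C))"

definition weight :: "('a list \<Rightarrow> complex) \<Rightarrow> 'v set \<Rightarrow> 'i set \<Rightarrow> ('i \<Rightarrow> 'v \<times> 'v \<times> 'a) \<Rightarrow> complex" where
  "weight \<kappa> V I d =
     (if ocactus V I d then \<Prod>C\<in>{C. C \<subseteq> I \<and> circuit d C}. pad_weight \<kappa> d C else 0)"

lemma relabel_simps [simp]:
  "esrc (relabel f e) = f (esrc e)" "etgt (relabel f e) = f (etgt e)" "elab (relabel f e) = elab e"
  by (simp_all add: relabel_def esrc_def etgt_def elab_def)

lemma relabel_relabel: "relabel f (relabel g e) = relabel (f \<circ> g) e"
  by (simp add: relabel_def esrc_def etgt_def elab_def)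

lemma relabel_case: "(case e of (x, y, a) \<Rightarrow> (f x, f y, a)) = relabel f e"
  by (cases e) (simp add: relabel_def esrc_def etgt_def elab_def)

lemma joins_relabel: "joins e x y \<Longrightarrow> joins (relabel f e) (f x) (f y)"
  by (auto simp: joins_def)

lemma directed_cycle_map:
  assumes "inj_on h (set es)"
    and "\<And>i. i \<in> set es \<Longrightarrow> d (h i) = relabel f (d' i)"
    and "\<And>i. i \<in> set es \<Longrightarrow> esrc (d' i) \<in> V \<and> etgt (d' i) \<in> V" and "inj_on f V"
  shows "directed_cycle d (map h es) \<longleftrightarrow> directed_cycle d' es"
proof -
  have "esrc (d (map h es ! i)) = etgt (d (map h es ! ((i + 1) mod length (map h es)))) \<longleftrightarrow>
      esrc (d' (es ! i)) = etgt (d' (es ! ((i + 1) mod length es)))" if i: "i < length es" for i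
  proof -
    have "(i + 1) mod length es < length es" using i by (intro mod_less_divisor) auto
    then have "es ! i \<in> set es" "es ! ((i + 1) mod length es) \<in> set es" using i by auto
    then show ?thesis
      using assms(2,3) i \<open>(i + 1) mod length es < length es\<close> inj_on_eq_iff[OF assms(4)] by simp
  qed
  then show ?thesis
    using assms(1) unfolding directed_cycle_def by (simp add: distinct_map)
qed

text \<open>Turns unique existence into a count, which can be transported along a bijection between
  families of pads.\<close>

lemma ex1_iff_card: "(\<exists>!x. P x) \<longleftrightarrow> card {x. P x} = 1"
proof -
  have "(\<exists>!x. P x) \<longleftrightarrow> (\<exists>x. {x. P x} = {x})" by (auto simp: set_eq_iff)
  then show ?thesis by (simp add: card_1_singleton_iff)
qed

lemma circuit_nonempty: "circuit d C \<Longrightarrow> C \<noteq> {}"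
  by (auto simp: circuit_def dependent_def)

text \<open>Isolates what the graph argument takes from the cumulants.\<close>

locale cyclic_cumulants =
  fixes \<kappa> :: "'a list \<Rightarrow> complex"
  assumes cumulant_rotate: "\<kappa> (rotate k as) = \<kappa> as"
begin

text \<open>Two directed listings of a circuit differ by a rotation, so the arbitrary choice in
  \<open>pad_weight\<close> can be replaced by any listing at hand.\<close>

lemma pad_weight_eq:
  assumes "circuit d (set es)" "directed_cycle d es"
  shows "pad_weight \<kappa> d (set es) = \<kappa> (map (\<lambda>i. elab (d i)) es)"
proof -
  let ?es = "SOME fs. directed_cycle d fs \<and> set fs = set es"
  have "directed_cycle d ?es \<and> set ?es = set es"
    by (rule someI[of _ es]) (use assms in auto)
  then obtain k where "?es = rotate k es"
    using directed_cycle_unique_up_to_rotation[OF assms(1) assms(2)] by blast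
  then show ?thesis by (simp add: pad_weight_def rotate_map[symmetric] cumulant_rotate)
qed

text \<open>Reachability is preserved and reflected by an injective renaming of vertices and edges,
  hence so are circuits, connectedness and the cactus conditions. The listings chosen on the two
  sides need not correspond; \<open>pad_weight_eq\<close> reconciles them.\<close>

lemma weight_iso:
  assumes h: "bij_betw h J I" and f: "inj_on f V'" and V: "V = f ` V'"
    and d: "\<And>j. j \<in> J \<Longrightarrow> d (h j) = relabel f (d' j)" and e: "edges_in V' J d'"
  shows "weight \<kappa> V I d = weight \<kappa> V' J d'"
proof -
  have hi: "inj_on h J" "I = h ` J" using h by (auto simp: bij_betw_def)
  have conn: "(f x, f y) \<in> (ustep d (h ` C))\<^sup>* \<longleftrightarrow> (x, y) \<in> (ustep d' C)\<^sup>*"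
    if C: "C \<subseteq> J" and xy: "x \<in> V'" "y \<in> V'" for C x y
  proof
    assume a: "(f x, f y) \<in> (ustep d (h ` C))\<^sup>*"
    \<comment> \<open>Reflection of reachability is preservation under the inverse of
      \<open>f\<close>, which is defined on \<open>V\<close> because all edges have their ends
      there.\<close>
    have "(inv_into V' f (f x), inv_into V' f (f y)) \<in> (ustep d' C)\<^sup>*"
    proof (rule conn_map[OF a])
      fix i u v assume "i \<in> h ` C" "joins (d i) u v"
      then obtain j where j: "j \<in> C" "j \<in> J" "joins (relabel f (d' j)) u v" using C d by auto
      then have "joins (d' j) (inv_into V' f u) (inv_into V' f v)"
        using e inv_into_f_f[OF f] by (auto simp: joins_def edges_in_def)
      then show "(inv_into V' f u, inv_into V' f v) \<in> (ustep d' C)\<^sup>*"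
        by (rule conn_joins[OF j(1)])
    qed
    then show "(x, y) \<in> (ustep d' C)\<^sup>*" using xy by (simp add: inv_into_f_f[OF f])
  next
    assume "(x, y) \<in> (ustep d' C)\<^sup>*"
    then show "(f x, f y) \<in> (ustep d (h ` C))\<^sup>*"
    proof (rule conn_map)
      fix i u v assume "i \<in> C" "joins (d' i) u v"
      moreover from this have "joins (d (h i)) (f u) (f v)"
        using d[of i] C joins_relabel[of "d' i" u v f] by auto
      ultimately show "(f u, f v) \<in> (ustep d (h ` C))\<^sup>*"
        by (intro conn_joins[of "h i"]) auto
    qed
  qed
  have dep: "dependent d (h ` C) \<longleftrightarrow> dependent d' C" if C: "C \<subseteq> J" for C
  proof -
    have "(esrc (d (h p)), etgt (d (h p))) \<in> (ustep d (h ` C - {h p}))\<^sup>* \<longleftrightarrow>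
        (esrc (d' p), etgt (d' p)) \<in> (ustep d' (C - {p}))\<^sup>*" if p: "p \<in> C" for p
    proof -
      have "h ` C - {h p} = h ` (C - {p})"
        using inj_on_image_set_diff[OF hi(1), of C "{p}"] C p by auto
      moreover have "esrc (d' p) \<in> V'" "etgt (d' p) \<in> V'" using e C p by (auto simp: edges_in_def)
      moreover have "d (h p) = relabel f (d' p)" using C p d by auto
      moreover have "C - {p} \<subseteq> J" using C by auto
      ultimately show ?thesis using conn[of "C - {p}" "esrc (d' p)" "etgt (d' p)"] by simp
    qed
    then show ?thesis unfolding dependent_def by simp
  qed
  have circ: "circuit d (h ` C) \<longleftrightarrow> circuit d' C" if C: "C \<subseteq> J" for C
  proof -
    have "{D. D \<subset> h ` C} = image h ` {D. D \<subset> C}"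
    proof (intro set_eqI iffI)
      fix D assume "D \<in> {D. D \<subset> h ` C}"
      then have D: "D \<subseteq> h ` C" "D \<noteq> h ` C" by auto
      from D(1) obtain D' where "D' \<subseteq> C" "D = h ` D'" by (rule subset_imageE)
      with D(2) show "D \<in> image h ` {D. D \<subset> C}" by auto
    next
      fix D assume "D \<in> image h ` {D. D \<subset> C}"
      then obtain D' where D': "D' \<subset> C" "D = h ` D'" by auto
      then have "h ` D' \<noteq> h ` C" using inj_on_image_eq_iff[OF hi(1), of D' C] C by auto
      then show "D \<in> {D. D \<subset> h ` C}" using D' by auto
    qed
    then have "(\<forall>D\<in>{D. D \<subset> h ` C}. \<not> dependent d D) \<longleftrightarrow> (\<forall>D\<in>{D. D \<subset> C}. \<not> dependent d (h ` D))"
      by (simp only: ball_simps)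
    also have "\<dots> \<longleftrightarrow> (\<forall>D\<in>{D. D \<subset> C}. \<not> dependent d' D)"
      by (rule ball_cong) (use dep C in auto)
    finally show ?thesis unfolding circuit_def using dep[OF C] by simp
  qed
  have pads: "{C. C \<subseteq> I \<and> circuit d C} = image h ` {C. C \<subseteq> J \<and> circuit d' C}"
    using circ by (auto simp: hi(2) subset_image_iff)
  have injp: "inj_on (image h) {C. C \<subseteq> J \<and> circuit d' C}"
    by (rule inj_on_subset[OF inj_on_image_Pow[OF hi(1)]]) auto
  have dir: "directed_cycle d (map h es) \<longleftrightarrow> directed_cycle d' es" if "set es \<subseteq> J" for es
    by (rule directed_cycle_map[of _ _ _ f _ V'])
       (use that d e f hi in \<open>auto simp: edges_in_def intro: inj_on_subset\<close>)
  have dirset: "(\<exists>es. directed_cycle d es \<and> set es = h ` C) \<longleftrightarrow> (\<exists>es. directed_cycle d' es \<and> set es = C)"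
    if C: "C \<subseteq> J" for C
  proof
    assume "\<exists>es. directed_cycle d es \<and> set es = h ` C"
    then obtain es where es: "directed_cycle d es" "set es = h ` C" by blast
    let ?es = "map (inv_into J h) es"
    have "h (inv_into J h e) = e" if "e \<in> set es" for e
      using that es(2) C by (intro f_inv_into_f) auto
    then have "es = map h ?es" by (simp add: map_idI)
    moreover have "set ?es = C" using es(2) inv_into_image_cancel[OF hi(1) C] by simp
    ultimately show "\<exists>es. directed_cycle d' es \<and> set es = C" using es(1) C dir by metis
  next
    assume "\<exists>es. directed_cycle d' es \<and> set es = C"
    then obtain es where "directed_cycle d' es" "set es = C" by blast
    then have "directed_cycle d (map h es) \<and> set (map h es) = h ` C" using C dir by auto
    then show "\<exists>es. directed_cycle d es \<and> set es = h ` C" by blast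
  qed
  have cg: "connected_graph V I d \<longleftrightarrow> connected_graph V' J d'"
  proof -
    have "edges_in V I d" using e d by (auto simp: edges_in_def V hi(2))
    then show ?thesis
      using e finite_image_iff[OF f] conn[OF subset_refl]
      by (simp add: connected_graph_def V hi(2))
  qed
  have un: "(\<forall>e\<in>I. \<exists>!C. C \<subseteq> I \<and> circuit d C \<and> e \<in> C) \<longleftrightarrow> (\<forall>e\<in>J. \<exists>!C. C \<subseteq> J \<and> circuit d' C \<and> e \<in> C)"
  proof -
    have "(\<exists>!C. C \<subseteq> I \<and> circuit d C \<and> h e \<in> C) \<longleftrightarrow> (\<exists>!C. C \<subseteq> J \<and> circuit d' C \<and> e \<in> C)"
      if e: "e \<in> J" for e
    proof -
      have "{C. C \<subseteq> I \<and> circuit d C \<and> h e \<in> C} = image h ` {C. C \<subseteq> J \<and> circuit d' C \<and> e \<in> C}"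
      proof -
        have "h e \<in> h ` C \<longleftrightarrow> e \<in> C" if "C \<subseteq> J" for C
          using inj_on_image_mem_iff[OF hi(1) e that] .
        moreover have "{C. C \<subseteq> I \<and> circuit d C \<and> h e \<in> C} = {C \<in> {C. C \<subseteq> I \<and> circuit d C}. h e \<in> C}"
          by auto
        ultimately show ?thesis unfolding pads by auto
      qed
      then have "card {C. C \<subseteq> I \<and> circuit d C \<and> h e \<in> C} = card {C. C \<subseteq> J \<and> circuit d' C \<and> e \<in> C}"
        using card_image[OF inj_on_subset[OF injp, of "{C. C \<subseteq> J \<and> circuit d' C \<and> e \<in> C}"]] by auto
      then show ?thesis unfolding ex1_iff_card by simp
    qed
    then show ?thesis by (simp add: hi(2))
  qed
  have "ocactus V I d \<longleftrightarrow> ocactus V' J d'"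
  proof -
    have "(\<forall>C. C \<subseteq> I \<and> circuit d C \<longrightarrow> (\<exists>es. directed_cycle d es \<and> set es = C)) \<longleftrightarrow>
        (\<forall>C\<in>{C. C \<subseteq> I \<and> circuit d C}. \<exists>es. directed_cycle d es \<and> set es = C)" by blast
    also have "\<dots> \<longleftrightarrow> (\<forall>C. C \<subseteq> J \<and> circuit d' C \<longrightarrow> (\<exists>es. directed_cycle d' es \<and> set es = C))"
      unfolding pads using dirset by auto
    finally show ?thesis unfolding ocactus_def using cg un by simp
  qed
  moreover have "(\<Prod>C\<in>{C. C \<subseteq> I \<and> circuit d C}. pad_weight \<kappa> d C) =
      (\<Prod>C\<in>{C. C \<subseteq> J \<and> circuit d' C}. pad_weight \<kappa> d' C)" if o: "ocactus V' J d'"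
    unfolding pads prod.reindex[OF injp] o_def
  proof (rule prod.cong)
    fix C assume "C \<in> {C. C \<subseteq> J \<and> circuit d' C}"
    then have C: "C \<subseteq> J" "circuit d' C" by auto
    then obtain es where es: "directed_cycle d' es" "set es = C" using o by (auto simp: ocactus_def)
    have "circuit d (set (map h es))" using circ C es by simp
    then have "pad_weight \<kappa> d (set (map h es)) = \<kappa> (map (\<lambda>i. elab (d i)) (map h es))"
      by (rule pad_weight_eq) (use dir es C in auto)
    also have "map (\<lambda>i. elab (d i)) (map h es) = map (\<lambda>i. elab (d' i)) es" using es C d by auto
    also have "\<kappa> \<dots> = pad_weight \<kappa> d' (set es)" using pad_weight_eq es C by metis
    finally show "pad_weight \<kappa> d (h ` C) = pad_weight \<kappa> d' C" using es by simp
  qed simp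
  ultimately show ?thesis by (simp add: weight_def)
qed

end

lemma urel_eq_ustep: "urel E = ustep ((!) E) {..<length E}"
proof -
  have "(\<exists>e\<in>set E. P e) \<longleftrightarrow> (\<exists>i\<in>{..<length E}. P (E ! i))" for P
    by (metis in_set_conv_nth lessThan_iff)
  then show ?thesis unfolding urel_def ustep_def joins_def by simp
qed

lemma connected_mg_iff: "connected_mg V E \<longleftrightarrow> connected_graph V {..<length E} ((!) E)"
  by (auto simp: connected_mg_def is_mgraph_def connected_graph_def edges_in_def all_set_conv_all_nth
      urel_eq_ustep)

lemma tau0_eq_weight: "tau0 \<kappa> V E = weight \<kappa> V {..<length E} ((!) E)"
proof -
  have pads: "pads E = {C. C \<subseteq> {..<length E} \<and> circuit ((!) E) C}"
    by (auto simp: pads_def is_scycle_iff_circuit)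
  have dc: "is_dcycle_list E es \<and> set es = C \<longleftrightarrow> directed_cycle ((!) E) es \<and> set es = C"
    if "C \<subseteq> {..<length E}" for C es
    using that by (auto simp: is_dcycle_list_def directed_cycle_def subset_iff)
  have dcx: "(\<exists>es. is_dcycle_list E es \<and> set es = C) \<longleftrightarrow> (\<exists>es. directed_cycle ((!) E) es \<and> set es = C)"
    if "C \<subseteq> {..<length E}" for C
    using dc[OF that] by simp
  have "oriented_cactus V E \<longleftrightarrow> ocactus V {..<length E} ((!) E)"
  proof -
    have "(\<forall>C\<in>pads E. \<exists>es. is_dcycle_list E es \<and> set es = C) \<longleftrightarrow>
        (\<forall>C. C \<subseteq> {..<length E} \<and> circuit ((!) E) C \<longrightarrow> (\<exists>es. directed_cycle ((!) E) es \<and> set es = C))"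
      unfolding pads using dcx by auto
    then show ?thesis
      unfolding oriented_cactus_def is_cactus_def ocactus_def connected_mg_iff is_scycle_iff_circuit
      by (simp add: Ball_def conj_assoc)
  qed
  moreover have "\<kappa> (map (\<lambda>i. elab (E ! i)) (SOME es. is_dcycle_list E es \<and> set es = C)) =
      pad_weight \<kappa> ((!) E) C" if "C \<in> pads E" for C
    using dc[of C] that by (simp add: pad_weight_def pads)
  ultimately show ?thesis by (simp add: tau0_def weight_def pads)
qed

section \<open>Cut vertices and sums over vertex partitions\<close>

locale cut_vertex =
  fixes V1 V2 :: "'v set" and I1 I2 :: "'i set" and d :: "'i \<Rightarrow> 'v \<times> 'v \<times> 'a" and w :: 'v
  assumes w: "V1 \<inter> V2 = {w}" and I: "I1 \<inter> I2 = {}"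
    and e1: "edges_in V1 I1 d" and e2: "edges_in V2 I2 d"
begin

lemma cut_vertex_swap: "cut_vertex V2 V1 I2 I1 d w"
  using w I e1 e2 by unfold_locales auto

text \<open>Sending all vertices outside \<open>V1\<close> to \<open>w\<close> is a retraction:
  edges of \<open>I1\<close> stay as they are, and edges of \<open>I2\<close> collapse to the point
  \<open>w\<close>. An excursion to the other side therefore disappears from the path.\<close>

lemma conn_restrict:
  assumes "(x, y) \<in> (ustep d C)\<^sup>*" "C \<subseteq> I1 \<union> I2" "x \<in> V1" "y \<in> V1"
  shows "(x, y) \<in> (ustep d (C \<inter> I1))\<^sup>*"
proof -
  let ?f = "\<lambda>x. if x \<in> V1 then x else w"
  have "(?f x, ?f y) \<in> (ustep d (C \<inter> I1))\<^sup>*"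
  proof (rule conn_map[OF assms(1)])
    fix i u v assume i: "i \<in> C" "joins (d i) u v"
    show "(?f u, ?f v) \<in> (ustep d (C \<inter> I1))\<^sup>*"
    proof (cases "i \<in> I1")
      case True
      then have "u \<in> V1" "v \<in> V1" using e1 i by (auto simp: edges_in_def joins_def)
      then show ?thesis using True i by (auto intro: conn_joins[of i])
    next
      case False
      then have "u \<in> V2" "v \<in> V2" using e2 i assms(2) by (auto simp: edges_in_def joins_def)
      then have "?f u = w" "?f v = w" using w by auto
      then show ?thesis by simp
    qed
  qed
  then show ?thesis using assms by simp
qed

text \<open>Retracting the bypass of \<open>p\<close> to the first side shows that
  \<open>C \<inter> I1\<close> is already dependent, so by minimality nothing of \<open>C\<close>
  lies outside \<open>I1\<close>.\<close>

lemma circuit_side1: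
  assumes "circuit d C" "C \<subseteq> I1 \<union> I2" "p \<in> C" "(esrc (d p), etgt (d p)) \<in> (ustep d (C - {p}))\<^sup>*" "p \<in> I1"
  shows "C \<subseteq> I1"
proof -
  have "esrc (d p) \<in> V1" "etgt (d p) \<in> V1" using e1 assms(5) by (auto simp: edges_in_def)
  then have "(esrc (d p), etgt (d p)) \<in> (ustep d ((C - {p}) \<inter> I1))\<^sup>*"
    using conn_restrict[OF assms(4)] assms(2) by auto
  moreover have "(C - {p}) \<inter> I1 = C \<inter> I1 - {p}" by auto
  ultimately have "dependent d (C \<inter> I1)" using assms(3,5) by (auto simp: dependent_def)
  then show ?thesis using assms(1) unfolding circuit_def by blast
qed

lemma circuit_sides:
  assumes "circuit d C" "C \<subseteq> I1 \<union> I2"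
  shows "C \<subseteq> I1 \<or> C \<subseteq> I2"
proof -
  interpret swap: cut_vertex V2 V1 I2 I1 d w by (rule cut_vertex_swap)
  obtain p where p: "p \<in> C" "(esrc (d p), etgt (d p)) \<in> (ustep d (C - {p}))\<^sup>*"
    using assms(1) by (auto simp: circuit_def dependent_def)
  then show ?thesis
    using circuit_side1[OF assms p] swap.circuit_side1[OF assms(1) _ p] assms(2) by blast
qed

lemma pads_union:
  "{C. C \<subseteq> I1 \<union> I2 \<and> circuit d C} = {C. C \<subseteq> I1 \<and> circuit d C} \<union> {C. C \<subseteq> I2 \<and> circuit d C}"
  using circuit_sides by blast

lemma connected_iff:
  "connected_graph (V1 \<union> V2) (I1 \<union> I2) d \<longleftrightarrow> connected_graph V1 I1 d \<and> connected_graph V2 I2 d"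
proof
  interpret swap: cut_vertex V2 V1 I2 I1 d w by (rule cut_vertex_swap)
  assume c: "connected_graph (V1 \<union> V2) (I1 \<union> I2) d"
  have *: "(x, y) \<in> (ustep d (I1 \<union> I2))\<^sup>*" if "x \<in> V1 \<union> V2" "y \<in> V1 \<union> V2" for x y
    using c that by (simp add: connected_graph_def)
  have "(x, y) \<in> (ustep d I1)\<^sup>*" if "x \<in> V1" "y \<in> V1" for x y
    using conn_restrict[OF *, of x y] that by (simp add: Int_absorb1)
  moreover have "(x, y) \<in> (ustep d I2)\<^sup>*" if "x \<in> V2" "y \<in> V2" for x y
    using swap.conn_restrict[OF *, of x y] that by (simp add: Int_absorb1 Un_commute)
  ultimately show "connected_graph V1 I1 d \<and> connected_graph V2 I2 d"
    using c w e1 e2 by (auto simp: connected_graph_def)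
next
  assume c: "connected_graph V1 I1 d \<and> connected_graph V2 I2 d"
  have "(x, w) \<in> (ustep d (I1 \<union> I2))\<^sup>*" if x: "x \<in> V1 \<union> V2" for x
  proof -
    have "(x, w) \<in> (ustep d I1)\<^sup>* \<or> (x, w) \<in> (ustep d I2)\<^sup>*"
      using x c w unfolding connected_graph_def by blast
    then show ?thesis using conn_mono by (metis sup_ge1 sup_ge2)
  qed
  then have "(x, y) \<in> (ustep d (I1 \<union> I2))\<^sup>*" if "x \<in> V1 \<union> V2" "y \<in> V1 \<union> V2" for x y
    using that conn_sym by (metis rtrancl_trans)
  then show "connected_graph (V1 \<union> V2) (I1 \<union> I2) d"
    using c e1 e2 by (auto simp: connected_graph_def edges_in_def)
qed

lemma ocactus_iff: "ocactus (V1 \<union> V2) (I1 \<union> I2) d \<longleftrightarrow> ocactus V1 I1 d \<and> ocactus V2 I2 d"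
proof -
  have "{C. C \<subseteq> I1 \<union> I2 \<and> circuit d C \<and> e \<in> C} = {C. C \<subseteq> I1 \<and> circuit d C \<and> e \<in> C}" if "e \<in> I1" for e
    using pads_union that I by blast
  then have u1: "(\<exists>!C. C \<subseteq> I1 \<union> I2 \<and> circuit d C \<and> e \<in> C) \<longleftrightarrow> (\<exists>!C. C \<subseteq> I1 \<and> circuit d C \<and> e \<in> C)"
    if "e \<in> I1" for e
    using that by (simp add: set_eq_iff)
  have "{C. C \<subseteq> I1 \<union> I2 \<and> circuit d C \<and> e \<in> C} = {C. C \<subseteq> I2 \<and> circuit d C \<and> e \<in> C}" if "e \<in> I2" for e
    using pads_union that I by blast
  then have u2: "(\<exists>!C. C \<subseteq> I1 \<union> I2 \<and> circuit d C \<and> e \<in> C) \<longleftrightarrow> (\<exists>!C. C \<subseteq> I2 \<and> circuit d C \<and> e \<in> C)"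
    if "e \<in> I2" for e
    using that by (simp add: set_eq_iff)
  have un: "(\<forall>e\<in>I1 \<union> I2. \<exists>!C. C \<subseteq> I1 \<union> I2 \<and> circuit d C \<and> e \<in> C) \<longleftrightarrow>
      (\<forall>e\<in>I1. \<exists>!C. C \<subseteq> I1 \<and> circuit d C \<and> e \<in> C) \<and> (\<forall>e\<in>I2. \<exists>!C. C \<subseteq> I2 \<and> circuit d C \<and> e \<in> C)"
    unfolding ball_Un by (intro arg_cong2[where f = "(\<and>)"] ball_cong refl) (erule u1, erule u2)
  have all: "(\<forall>C. C \<subseteq> I1 \<union> I2 \<and> circuit d C \<longrightarrow> Q C) \<longleftrightarrow>
      (\<forall>C. C \<subseteq> I1 \<and> circuit d C \<longrightarrow> Q C) \<and> (\<forall>C. C \<subseteq> I2 \<and> circuit d C \<longrightarrow> Q C)" for Q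
    using circuit_sides by blast
  show ?thesis
    unfolding ocactus_def connected_iff un all by (simp only: conj_ac)
qed

text \<open>No circuit crosses a cut vertex, so the pads of the union are those of the two sides and
  the product over pads factors.\<close>

lemma weight_cut_vertex:
  assumes "finite I1" "finite I2"
  shows "weight \<kappa> (V1 \<union> V2) (I1 \<union> I2) d = weight \<kappa> V1 I1 d * weight \<kappa> V2 I2 d"
proof -
  \<comment> \<open>Disjointness of the families needs circuits to be nonempty: the empty set is
    contained in both \<open>I1\<close> and \<open>I2\<close>.\<close>
  have "{C. C \<subseteq> I1 \<and> circuit d C} \<inter> {C. C \<subseteq> I2 \<and> circuit d C} = {}"
    using I circuit_nonempty by blast
  moreover have "finite {C. C \<subseteq> J \<and> circuit d C}" if "finite J" for J
    by (rule finite_subset[of _ "Pow J"]) (use that in auto)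
  ultimately show ?thesis
    using assms by (simp add: weight_def ocactus_iff pads_union prod.union_disjoint)
qed

end

section \<open>Sums over vertex partitions, encoded by equivalence relations\<close>

definition eqrels :: "'v set \<Rightarrow> ('v \<times> 'v) set set" where
  "eqrels V = {r. equiv V r}"

definition quot_weight ::
  "('a list \<Rightarrow> complex) \<Rightarrow> 'v set \<Rightarrow> 'i set \<Rightarrow> ('i \<Rightarrow> 'v \<times> 'v \<times> 'a) \<Rightarrow> ('v \<times> 'v) set \<Rightarrow> complex" where
  "quot_weight \<kappa> V I d r = weight \<kappa> ((\<lambda>x. r `` {x}) ` V) I (relabel (\<lambda>x. r `` {x}) \<circ> d)"

text \<open>With relations in place of partitions, restriction to \<open>W\<close> is an
  intersection, and keeping the vertices of \<open>W\<close> apart is a single equation. For empty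
  \<open>W\<close> this is the full sum defining \<open>tau\<close>; for \<open>W\<close> the
  vertices of \<open>t\<close> it is the part that identifies no two of them.\<close>

definition sep_sum ::
  "('a list \<Rightarrow> complex) \<Rightarrow> 'v set \<Rightarrow> 'v set \<Rightarrow> 'i set \<Rightarrow> ('i \<Rightarrow> 'v \<times> 'v \<times> 'a) \<Rightarrow> complex" where
  "sep_sum \<kappa> W V I d = (\<Sum>r | r \<in> eqrels V \<and> r \<inter> W \<times> W = Id_on W. quot_weight \<kappa> V I d r)"

lemma finite_eqrels: "finite V \<Longrightarrow> finite (eqrels V)"
  by (rule finite_subset[of _ "Pow (V \<times> V)"]) (auto simp: eqrels_def equiv_def refl_on_def)

lemma eqrels_subset: "r \<in> eqrels V \<Longrightarrow> r \<subseteq> V \<times> V"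
  by (auto simp: eqrels_def equiv_def refl_on_def)

lemma eqrels_refl: "r \<in> eqrels V \<Longrightarrow> x \<in> V \<Longrightarrow> (x, x) \<in> r"
  by (auto simp: eqrels_def equiv_def refl_on_def)

lemma eqrels_sym: "r \<in> eqrels V \<Longrightarrow> (x, y) \<in> r \<Longrightarrow> (y, x) \<in> r"
  by (auto simp: eqrels_def equiv_def dest: symD)

lemma eqrels_trans: "r \<in> eqrels V \<Longrightarrow> (x, y) \<in> r \<Longrightarrow> (y, z) \<in> r \<Longrightarrow> (x, z) \<in> r"
  unfolding eqrels_def equiv_def by (blast dest: transD)

lemma eqrelsI:
  assumes "r \<subseteq> V \<times> V" "\<And>x. x \<in> V \<Longrightarrow> (x, x) \<in> r" "\<And>x y. (x, y) \<in> r \<Longrightarrow> (y, x) \<in> r"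
    "\<And>x y z. (x, y) \<in> r \<Longrightarrow> (y, z) \<in> r \<Longrightarrow> (x, z) \<in> r"
  shows "r \<in> eqrels V"
  using assms unfolding eqrels_def equiv_def refl_on_def sym_def trans_def by blast

lemma edges_in_relabel: "edges_in V I d \<Longrightarrow> edges_in (q ` V) I (relabel q \<circ> d)"
  by (auto simp: edges_in_def)

context cyclic_cumulants
begin

lemma tau_eq_sum:
  assumes "edges_in V {..<length E} ((!) E)" "finite V"
  shows "tau \<kappa> V E = sep_sum \<kappa> {} V {..<length E} ((!) E)"
proof -
  have bij: "bij_betw (\<lambda>r. V // r) (eqrels V) {\<pi>. partition_on V \<pi>}"
  proof (rule bij_betwI[where g = "\<lambda>\<pi>. {(x, y). \<exists>p\<in>\<pi>. x \<in> p \<and> y \<in> p}"])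
    show "(\<lambda>r. V // r) \<in> eqrels V \<rightarrow> {\<pi>. partition_on V \<pi>}"
      by (auto simp: eqrels_def partition_on_quotient)
    show "(\<lambda>\<pi>. {(x, y). \<exists>p\<in>\<pi>. x \<in> p \<and> y \<in> p}) \<in> {\<pi>. partition_on V \<pi>} \<rightarrow> eqrels V"
      by (auto simp: eqrels_def equiv_partition_on)
    fix \<pi> assume "\<pi> \<in> {\<pi>. partition_on V \<pi>}"
    then show "V // {(x, y). \<exists>p\<in>\<pi>. x \<in> p \<and> y \<in> p} = \<pi>" by (simp add: partition_on_eq_quotient)
  next
    fix r assume r: "r \<in> eqrels V"
    then have e: "equiv V r" by (simp add: eqrels_def)
    show "{(x, y). \<exists>p\<in>V // r. x \<in> p \<and> y \<in> p} = r"
    proof (intro set_eqI iffI; clarify)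
      fix x y p assume "p \<in> V // r" "x \<in> p" "y \<in> p"
      then show "(x, y) \<in> r" using in_quotient_imp_in_rel[OF e] by auto
    next
      fix x y assume "(x, y) \<in> r"
      then show "\<exists>p\<in>V // r. x \<in> p \<and> y \<in> p"
        using eqrels_subset[OF r] eqrels_refl[OF r]
        by (intro bexI[of _ "r `` {x}"]) (auto intro: quotientI)
    qed
  qed
  have "tau \<kappa> V E = (\<Sum>r\<in>eqrels V. tau0 \<kappa> (V // r) (quot_edges (V // r) E))"
    unfolding tau_def by (rule sum.reindex_bij_betw[OF bij, symmetric])
  also have "\<dots> = (\<Sum>r\<in>eqrels V. quot_weight \<kappa> V {..<length E} ((!) E) r)"
  proof (rule sum.cong)
    fix r assume r: "r \<in> eqrels V"
    then have e: "equiv V r" by (simp add: eqrels_def)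
    have b: "blk (V // r) x = r `` {x}" if "x \<in> V" for x
      unfolding blk_def
    proof (rule the_equality)
      show "r `` {x} \<in> V // r \<and> x \<in> r `` {x}" using that r eqrels_refl by (auto intro: quotientI)
      fix B assume "B \<in> V // r \<and> x \<in> B"
      then obtain y where "y \<in> V" "B = r `` {y}" "x \<in> r `` {y}" by (auto elim: quotientE)
      then show "B = r `` {x}" using equiv_class_eq[OF e, of y x] by auto
    qed
    have "quot_edges (V // r) E = map (relabel (\<lambda>x. r `` {x})) E"
      unfolding quot_edges_def relabel_case
    proof (rule map_cong)
      fix e assume "e \<in> set E"
      then have "esrc e \<in> V" "etgt e \<in> V" using assms by (auto simp: edges_in_def in_set_conv_nth)
      then show "relabel (blk (V // r)) e = relabel (\<lambda>x. r `` {x}) e"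
        by (simp add: relabel_def b)
    qed simp
    moreover have "V // r = (\<lambda>x. r `` {x}) ` V" by (auto simp: quotient_def)
    ultimately show "tau0 \<kappa> (V // r) (quot_edges (V // r) E) = quot_weight \<kappa> V {..<length E} ((!) E) r"
      using assms(1) unfolding quot_weight_def tau0_eq_weight
      by (auto intro!: weight_iso[where h = id and f = id] simp: bij_betw_def relabel_def esrc_def etgt_def elab_def edges_in_def)
  qed simp
  finally show ?thesis by (simp add: sep_sum_def)
qed

text \<open>A quotient graph is determined up to isomorphism by the kernel of the vertex map, so
  classes may be replaced by whatever names \<open>q\<close> provides.\<close>

lemma quot_weight_kernel:
  assumes r: "r \<in> eqrels V" and e: "edges_in V I d"
    and q: "\<And>x y. x \<in> V \<Longrightarrow> y \<in> V \<Longrightarrow> q x = q y \<longleftrightarrow> (x, y) \<in> r"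
  shows "quot_weight \<kappa> V I d r = weight \<kappa> (q ` V) I (relabel q \<circ> d)"
proof -
  have cls: "r `` {x} = r `` {y} \<longleftrightarrow> q x = q y" if "x \<in> V" "y \<in> V" for x y
    using r that q eq_equiv_class_iff[of V r x y] by (simp add: eqrels_def)
  define f where "f B = r `` {inv_into V q B}" for B
  have f: "f (q x) = r `` {x}" if "x \<in> V" for x
    unfolding f_def using that by (subst cls) (auto intro: inv_into_into f_inv_into_f)
  show ?thesis
    unfolding quot_weight_def
  proof (rule weight_iso[where h = id and f = f])
    show "inj_on f (q ` V)" by (auto simp: inj_on_def f cls)
    show "(\<lambda>x. r `` {x}) ` V = f ` q ` V" by (auto simp: f image_image)
    show "edges_in (q ` V) I (relabel q \<circ> d)" using edges_in_relabel[OF e] .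
    fix i assume "i \<in> I"
    then show "(relabel (\<lambda>x. r `` {x}) \<circ> d) (id i) = relabel f ((relabel q \<circ> d) i)"
      using e by (simp add: edges_in_def f relabel_def esrc_def etgt_def elab_def)
  qed simp
qed

text \<open>Since \<open>q\<close> identifies vertices only inside \<open>W\<close>, a relation
  whose trace on \<open>W\<close> is the kernel of \<open>q\<close> contains the whole kernel and
  descends to \<open>q\<close> V\<open>, where it separates\<close>q \<open>W\<close>. Pulling back
  along \<open>q\<close> is inverse to this, and quotienting in two stages gives the same graph. An
  injective \<open>q\<close> yields invariance under renaming; a proper quotient of \<open>W\<close>
  yields the sum over relations with a prescribed trace.\<close>

lemma sep_sum_pullback:
  assumes h: "bij_betw h J I" and d': "\<And>j. j \<in> J \<Longrightarrow> d' (h j) = relabel q (d j)"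
    and e: "edges_in V J d" and W: "W \<subseteq> V"
    and q: "\<And>x y. x \<in> V \<Longrightarrow> y \<in> V \<Longrightarrow> q x = q y \<Longrightarrow> x = y \<or> (x \<in> W \<and> y \<in> W)"
  shows "(\<Sum>r | r \<in> eqrels V \<and> r \<inter> W \<times> W = {(x, y). x \<in> W \<and> y \<in> W \<and> q x = q y}. quot_weight \<kappa> V J d r)
    = sep_sum \<kappa> (q ` W) (q ` V) I d'"
proof -
  define pb where "pb r' = {(x, y). x \<in> V \<and> y \<in> V \<and> (q x, q y) \<in> r'}" for r'
  let ?A = "{r'. r' \<in> eqrels (q ` V) \<and> r' \<inter> (q ` W) \<times> (q ` W) = Id_on (q ` W)}"
  let ?B = "{r. r \<in> eqrels V \<and> r \<inter> W \<times> W = {(x, y). x \<in> W \<and> y \<in> W \<and> q x = q y}}"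
  have pbeq: "pb r' \<in> eqrels V" if r': "r' \<in> eqrels (q ` V)" for r'
  proof (rule eqrelsI)
    show "pb r' \<subseteq> V \<times> V" by (auto simp: pb_def)
    show "(x, x) \<in> pb r'" if "x \<in> V" for x using that eqrels_refl[OF r'] by (simp add: pb_def)
    show "(y, x) \<in> pb r'" if "(x, y) \<in> pb r'" for x y
      using that eqrels_sym[OF r', of "q x" "q y"] by (simp add: pb_def)
    show "(x, z) \<in> pb r'" if "(x, y) \<in> pb r'" "(y, z) \<in> pb r'" for x y z
      using that eqrels_trans[OF r', of "q x" "q y" "q z"] by (simp add: pb_def)
  qed
  have bij: "bij_betw pb ?A ?B"
  proof (rule bij_betwI[where g = "\<lambda>r. map_prod q q ` r"])
    show "pb \<in> ?A \<rightarrow> ?B"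
    proof
      fix r' assume r': "r' \<in> ?A"
      have "(q x, q y) \<in> r' \<longleftrightarrow> q x = q y" if "x \<in> W" "y \<in> W" for x y
      proof -
        have "(q x, q y) \<in> r' \<inter> (q ` W) \<times> (q ` W) \<longleftrightarrow> (q x, q y) \<in> Id_on (q ` W)" using r' by simp
        then show ?thesis using that by auto
      qed
      then have "pb r' \<inter> W \<times> W = {(x, y). x \<in> W \<and> y \<in> W \<and> q x = q y}"
        using W by (auto simp: pb_def)
      then show "pb r' \<in> ?B" using pbeq r' by simp
    qed
    show "(\<lambda>r. map_prod q q ` r) \<in> ?B \<rightarrow> ?A"
    proof
      fix r assume "r \<in> ?B"
      then have r: "r \<in> eqrels V" and rW: "r \<inter> W \<times> W = {(x, y). x \<in> W \<and> y \<in> W \<and> q x = q y}" by auto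
      have ker: "(x, y) \<in> r" if "x \<in> V" "y \<in> V" "q x = q y" for x y
        using q[OF that] eqrels_refl[OF r] that rW by blast
      have mem: "(q x, q y) \<in> map_prod q q ` r \<longleftrightarrow> (x, y) \<in> r" if "x \<in> V" "y \<in> V" for x y
      proof
        assume "(q x, q y) \<in> map_prod q q ` r"
        then obtain x1 y1 where "(x1, y1) \<in> r" "q x = q x1" "q y = q y1" by auto
        moreover from this have "x1 \<in> V" "y1 \<in> V" using eqrels_subset[OF r] by auto
        ultimately show "(x, y) \<in> r"
          using ker[of x x1] ker[of y1 y] that eqrels_trans[OF r] by metis
      qed force
      have sub: "map_prod q q ` r \<subseteq> q ` V \<times> q ` V" using eqrels_subset[OF r] by auto
      have "map_prod q q ` r \<in> eqrels (q ` V)"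
      proof (rule eqrelsI[OF sub])
        fix x assume "x \<in> q ` V"
        then show "(x, x) \<in> map_prod q q ` r" using mem eqrels_refl[OF r] by auto
      next
        fix x y assume xy: "(x, y) \<in> map_prod q q ` r"
        then obtain a b where "a \<in> V" "b \<in> V" "x = q a" "y = q b" using sub by blast
        then show "(y, x) \<in> map_prod q q ` r" using mem xy eqrels_sym[OF r] by simp
      next
        fix x y z assume xy: "(x, y) \<in> map_prod q q ` r" "(y, z) \<in> map_prod q q ` r"
        obtain a b where ab: "a \<in> V" "b \<in> V" "x = q a" "y = q b" using sub xy(1) by blast
        obtain c where c: "c \<in> V" "z = q c" using sub xy(2) by blast
        have "(a, b) \<in> r" "(b, c) \<in> r" using mem[of a b] mem[of b c] xy ab c by simp_all
        then have "(a, c) \<in> r" by (rule eqrels_trans[OF r])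
        then show "(x, z) \<in> map_prod q q ` r" using mem[of a c] ab c by simp
      qed
      moreover have "map_prod q q ` r \<inter> (q ` W) \<times> (q ` W) = Id_on (q ` W)"
      proof (intro set_eqI iffI)
        fix p assume p: "p \<in> map_prod q q ` r \<inter> (q ` W) \<times> (q ` W)"
        then obtain a b where ab: "a \<in> W" "b \<in> W" "p = (q a, q b)" by blast
        then have "(a, b) \<in> r" using mem[of a b] p W by auto
        then have "q a = q b" using rW ab by blast
        then show "p \<in> Id_on (q ` W)" using ab by auto
      next
        fix p assume "p \<in> Id_on (q ` W)"
        then obtain a where "a \<in> W" "p = (q a, q a)" by auto
        moreover from this have "(q a, q a) \<in> map_prod q q ` r" using mem[of a a] eqrels_refl[OF r] W by auto
        ultimately show "p \<in> map_prod q q ` r \<inter> (q ` W) \<times> (q ` W)" by simp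
      qed
      ultimately show "map_prod q q ` r \<in> ?A" by simp
    qed
    fix r' assume "r' \<in> ?A"
    then have "r' \<subseteq> q ` V \<times> q ` V" using eqrels_subset by blast
    then show "map_prod q q ` pb r' = r'" unfolding pb_def by force
  next
    fix r assume "r \<in> ?B"
    then have r: "r \<in> eqrels V" and rW: "r \<inter> W \<times> W = {(x, y). x \<in> W \<and> y \<in> W \<and> q x = q y}" by auto
    have ker: "(x, y) \<in> r" if "x \<in> V" "y \<in> V" "q x = q y" for x y
      using q[OF that] eqrels_refl[OF r] that rW by blast
    show "pb (map_prod q q ` r) = r"
    proof (intro set_eqI iffI)
      fix p assume "p \<in> pb (map_prod q q ` r)"
      then obtain x y x1 y1 where p: "p = (x, y)" "x \<in> V" "y \<in> V" "(x1, y1) \<in> r" "q x = q x1" "q y = q y1"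
        by (auto simp: pb_def)
      moreover from this have "x1 \<in> V" "y1 \<in> V" using eqrels_subset[OF r] by auto
      ultimately show "p \<in> r"
        using ker[of x x1] ker[of y1 y] eqrels_trans[OF r] by metis
    next
      fix p assume "p \<in> r"
      then show "p \<in> pb (map_prod q q ` r)" using eqrels_subset[OF r] by (force simp: pb_def)
    qed
  qed
  have "quot_weight \<kappa> V J d (pb r') = quot_weight \<kappa> (q ` V) I d' r'" if r': "r' \<in> ?A" for r'
  proof -
    let ?p = "\<lambda>x. r' `` {q x}"
    have r'e: "r' \<in> eqrels (q ` V)" using r' by simp
    have "quot_weight \<kappa> V J d (pb r') = weight \<kappa> (?p ` V) J (relabel ?p \<circ> d)"
    proof (rule quot_weight_kernel[OF pbeq[OF r'e] e])
      fix x y assume "x \<in> V" "y \<in> V"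
      then show "?p x = ?p y \<longleftrightarrow> (x, y) \<in> pb r'"
        using eq_equiv_class_iff[of "q ` V" r' "q x" "q y"] r'e by (simp add: eqrels_def pb_def)
    qed
    also have "\<dots> = quot_weight \<kappa> (q ` V) I d' r'"
      unfolding quot_weight_def
    proof (rule weight_iso[where h = h and f = id, OF h, symmetric])
      show "edges_in (?p ` V) J (relabel ?p \<circ> d)" using edges_in_relabel[OF e] .
      fix j assume "j \<in> J"
      then show "(relabel (\<lambda>x. r' `` {x}) \<circ> d') (h j) = relabel id ((relabel ?p \<circ> d) j)"
        by (simp add: d' relabel_relabel comp_def)
    qed (auto simp: image_image)
    finally show ?thesis .
  qed
  then have "sep_sum \<kappa> (q ` W) (q ` V) I d' = (\<Sum>r'\<in>?A. quot_weight \<kappa> V J d (pb r'))"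
    unfolding sep_sum_def by (intro sum.cong) auto
  also have "\<dots> = (\<Sum>r\<in>?B. quot_weight \<kappa> V J d r)"
    by (rule sum.reindex_bij_betw[OF bij])
  finally show ?thesis by simp
qed

end

section \<open>Removing a pad\<close>

lemma conn_relabel:
  assumes "(x, y) \<in> (ustep d C)\<^sup>*"
  shows "(q x, q y) \<in> (ustep (relabel q \<circ> d) C)\<^sup>*"
  by (rule conn_map[OF assms]) (auto intro!: conn_joins dest: joins_relabel)

text \<open>An explicit simple cycle only needs its own vertices to stay distinct. Hence it survives
  in a larger graph and in a quotient that merges other vertices.\<close>

lemma circuit_map:
  assumes P: "circuit d' P" "edges_in W P d'" and f: "inj_on f W" and h: "inj_on h P"
    and d: "\<And>i. i \<in> P \<Longrightarrow> d (h i) = relabel f (d' i)"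
  shows "circuit d (h ` P)"
proof -
  obtain vs es where c: "simple_cycle d' vs es" "set es = P" using circuit_simple_cycle[OF P(1)] .
  have n: "length vs = length es" "\<And>i. i < length es \<Longrightarrow> (i + 1) mod length es < length es"
    and j: "\<And>i. i < length es \<Longrightarrow> joins (d' (es ! i)) (vs ! i) (vs ! ((i + 1) mod length es))"
    using c(1) by (auto simp: simple_cycle_def)
  have "set vs \<subseteq> W"
  proof
    fix v assume "v \<in> set vs"
    then obtain i where i: "i < length es" "v = vs ! i" using n(1) by (metis in_set_conv_nth)
    then have "es ! i \<in> P" using c(2) by auto
    then show "v \<in> W" using j[OF i(1)] P(2) i(2) by (auto simp: edges_in_def joins_def)
  qed
  then have "distinct (map f vs)"
    using c(1) f by (auto simp: simple_cycle_def distinct_map intro: inj_on_subset)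
  moreover have "distinct (map h es)"
    using c h by (auto simp: simple_cycle_def distinct_map)
  moreover have "joins (d (h (es ! i))) (f (vs ! i)) (f (vs ! ((i + 1) mod length es)))"
    if "i < length es" for i
    using joins_relabel[OF j[OF that]] d[of "es ! i"] c(2) that by auto
  ultimately have "simple_cycle d (map f vs) (map h es)"
    using c(1) n by (auto simp: simple_cycle_def)
  then show ?thesis using simple_cycle_circuit c(2) by fastforce
qed

lemma eqrels_extend: "R \<in> eqrels V1 \<Longrightarrow> R \<union> Id_on V2 \<in> eqrels (V1 \<union> V2)"
  by (rule eqrelsI) (auto dest: eqrels_subset eqrels_refl eqrels_sym eqrels_trans)

lemma eqrels_restrict: "R \<in> eqrels V \<Longrightarrow> V1 \<subseteq> V \<Longrightarrow> R \<inter> V1 \<times> V1 \<in> eqrels V1"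
  by (rule eqrelsI) (auto dest: eqrels_refl eqrels_sym eqrels_trans)

section \<open>Vertices of a pad and the root component of its complement\<close>

definition ends :: "('i \<Rightarrow> 'v \<times> 'v \<times> 'a) \<Rightarrow> 'i set \<Rightarrow> 'v set" where
  "ends d P = {x. \<exists>p\<in>P. \<exists>y. joins (d p) x y}"

text \<open>Follow the walk towards \<open>P\<close> and stop at its first vertex of
  \<open>P\<close>; no edge of \<open>P\<close> has been used before that.\<close>

lemma ends_reachable:
  assumes "(x, y) \<in> (ustep d K)\<^sup>*" "y \<in> ends d P"
  shows "\<exists>v\<in>ends d P. (x, v) \<in> (ustep d (K - P))\<^sup>*"
  using assms(1)
proof (induction rule: converse_rtrancl_induct)
  case base
  then show ?case using assms(2) by blast
next
  case (step x z)
  then obtain i where i: "i \<in> K" "joins (d i) x z" by (auto simp: ustep_def)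
  show ?case
  proof (cases "i \<in> P")
    case True
    then show ?thesis using i by (auto simp: ends_def)
  next
    case False
    then have "(x, z) \<in> (ustep d (K - P))\<^sup>*" using i by (intro conn_joins) auto
    then show ?thesis using step.IH by (meson rtrancl_trans)
  qed
qed

definition component :: "'v set \<Rightarrow> 'i set \<Rightarrow> ('i \<Rightarrow> 'v \<times> 'v \<times> 'a) \<Rightarrow> 'v \<Rightarrow> 'v set" where
  "component W K d r = {x \<in> W. (r, x) \<in> (ustep d K)\<^sup>*}"

definition component_edges :: "'v set \<Rightarrow> 'i set \<Rightarrow> ('i \<Rightarrow> 'v \<times> 'v \<times> 'a) \<Rightarrow> 'v \<Rightarrow> 'i set" where
  "component_edges W K d r = {i \<in> K. esrc (d i) \<in> component W K d r}"

lemma component_closed: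
  assumes "edges_in W K d" "i \<in> K" "joins (d i) x y" "x \<in> component W K d r"
  shows "y \<in> component W K d r"
proof -
  have "y \<in> W" using assms by (auto simp: edges_in_def joins_def)
  moreover have "(x, y) \<in> (ustep d K)\<^sup>*" using assms by (intro conn_joins)
  ultimately show ?thesis using assms(4) by (auto simp: component_def)
qed

lemma connected_component:
  assumes "finite W" "edges_in W K d" "r \<in> W"
  shows "connected_graph (component W K d r) (component_edges W K d r) d"
proof -
  let ?W = "component W K d r" and ?K = "component_edges W K d r"
  have ein: "edges_in ?W ?K d"
    using component_closed[OF assms(2) _ joins_self]
    by (auto simp: edges_in_def component_edges_def)
  have rx: "x \<in> ?W \<and> (r, x) \<in> (ustep d ?K)\<^sup>*" if "(r, x) \<in> (ustep d K)\<^sup>*" for x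
    using that
  proof (induction rule: rtrancl_induct)
    case base
    then show ?case using assms(3) by (simp add: component_def)
  next
    case (step y z)
    then obtain i where i: "i \<in> K" "joins (d i) y z" by (auto simp: ustep_def)
    have z: "z \<in> ?W" using component_closed[OF assms(2) i] step.IH by simp
    then have "i \<in> ?K" using i step.IH by (auto simp: component_edges_def joins_def)
    then have "(y, z) \<in> (ustep d ?K)\<^sup>*" using i by (intro conn_joins)
    then show ?case using step.IH z by (meson rtrancl_trans)
  qed
  have "(x, y) \<in> (ustep d ?K)\<^sup>*" if "x \<in> ?W" "y \<in> ?W" for x y
    using rx[of x] rx[of y] that conn_sym by (fastforce simp: component_def)
  moreover have "finite ?W" using assms(1) by (simp add: component_def)
  moreover have "r \<in> ?W" using assms(3) by (simp add: component_def)
  ultimately show ?thesis using ein by (auto simp: connected_graph_def)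
qed

text \<open>An edge of \<open>P\<close> can touch the component only at a vertex of the pad, hence
  only at \<open>w\<close>. Any other edge touching the component belongs to it.\<close>

lemma edges_in_component_complement:
  assumes e: "edges_in W K d" and w: "ends d P \<inter> component W (K - P) d r = {w}"
  shows "edges_in (W - component W (K - P) d r \<union> {w}) (K - component_edges W (K - P) d r) d"
  unfolding edges_in_def
proof
  let ?W = "component W (K - P) d r"
  have e': "edges_in W (K - P) d" using e by (auto simp: edges_in_def)
  fix i assume i: "i \<in> K - component_edges W (K - P) d r"
  have "x \<in> W - ?W \<union> {w}" if x: "joins (d i) x y" for x y
  proof (cases "i \<in> P")
    case True
    then have "x \<in> ends d P" using x by (auto simp: ends_def)
    then show ?thesis using w x i e by (auto simp: edges_in_def joins_def)
  next
    case False
    then have "esrc (d i) \<notin> ?W" using i by (auto simp: component_edges_def)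
    moreover have "etgt (d i) \<notin> ?W"
      using component_closed[OF e', of i "etgt (d i)" "esrc (d i)" r] False i calculation
      by (auto simp: joins_def)
    ultimately show ?thesis using x i e by (auto simp: edges_in_def joins_def)
  qed
  then show "esrc (d i) \<in> W - ?W \<union> {w} \<and> etgt (d i) \<in> W - ?W \<union> {w}"
    using joins_self joins_commute by metis
qed

context cyclic_cumulants
begin

text \<open>Here \<open>W\<close>, \<open>K\<close> play the role of \<open>t\<close> and
  \<open>X\<close>, \<open>J\<close> that of \<open>u\<close>; the two meet in the root
  \<open>r\<close>, and \<open>P\<close> is a cycle of \<open>t\<close>.\<close>

context
  fixes W X :: "'v set" and K J P :: "'i set" and d :: "'i \<Rightarrow> 'v \<times> 'v \<times> 'a" and r :: 'v
  assumes W: "connected_graph W K d" and X: "connected_graph X J d" and WX: "W \<inter> X = {r}"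
    and KJ: "K \<inter> J = {}" "finite K" "finite J" and P: "P \<subseteq> K" "circuit d P"
begin

text \<open>A nonzero term comes from an oriented cactus. Its quotient map is injective on
  \<open>W\<close>, so \<open>P\<close> is still a circuit there, and separation of pad vertices
  applies inside the quotient, where paths may also use edges of \<open>J\<close> and merged
  vertices.\<close>

lemma pad_ends_separated:
  assumes R: "R \<in> eqrels (W \<union> X)" "R \<inter> W \<times> W = Id_on W"
    and nz: "quot_weight \<kappa> (W \<union> X) (K \<union> J) d R \<noteq> 0"
    and xy: "x \<in> ends d P" "y \<in> ends d P" "x \<noteq> y"
  shows "(R `` {x}, R `` {y}) \<notin> (ustep (relabel (\<lambda>x. R `` {x}) \<circ> d) (K \<union> J - P))\<^sup>*"
proof -
  let ?q = "\<lambda>x. R `` {x}"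
  let ?d = "relabel ?q \<circ> d"
  have eW: "edges_in W K d" using W by (simp add: connected_graph_def)
  have inj: "inj_on ?q W"
  proof (rule inj_onI)
    fix a b assume ab: "a \<in> W" "b \<in> W" "?q a = ?q b"
    then have "(a, b) \<in> R" using eqrels_refl[OF R(1), of b] by blast
    then show "a = b" using R(2) ab by auto
  qed
  have oc: "ocactus (?q ` (W \<union> X)) (K \<union> J) ?d"
    using nz by (auto simp: quot_weight_def weight_def split: if_splits)
  have circ: "circuit ?d P"
    using circuit_map[OF P(2) _ inj, of id ?d] eW P(1) by (auto simp: edges_in_def)
  obtain p x' where p: "p \<in> P" "joins (d p) x x'" using xy(1) by (auto simp: ends_def)
  obtain p' y' where p': "p' \<in> P" "joins (d p') y y'" using xy(2) by (auto simp: ends_def)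
  have "x \<in> W" "y \<in> W" using p p' eW P(1) by (auto simp: edges_in_def joins_def)
  then have ne: "?q x \<noteq> ?q y" using inj xy(3) by (auto simp: inj_on_def)
  show ?thesis
  proof (rule circuit_vertices_separated[OF _ _ circ p(1) _ p'(1) _ ne])
    show "P \<subseteq> K \<union> J" using P(1) by auto
    show "\<exists>!C. C \<subseteq> K \<union> J \<and> circuit ?d C \<and> e \<in> C" if "e \<in> P" for e
    proof -
      have "\<forall>e\<in>K \<union> J. \<exists>!C. C \<subseteq> K \<union> J \<and> circuit ?d C \<and> e \<in> C"
        using oc by (simp add: ocactus_def)
      then show ?thesis by (rule bspec) (use that P(1) in auto)
    qed
    show "joins (?d p) (?q x) (?q x')" using joins_relabel[OF p(2)] by simp
    show "joins (?d p') (?q y) (?q y')" using joins_relabel[OF p'(2)] by simp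
  qed
qed

text \<open>Two vertices of the cycle linked off the cycle in \<open>W\<close> remain linked in
  every quotient, so no quotient is a cactus.\<close>

lemma sep_sum_eq_0:
  assumes "x \<in> ends d P \<inter> component W (K - P) d r" "y \<in> ends d P \<inter> component W (K - P) d r" "x \<noteq> y"
  shows "sep_sum \<kappa> W (W \<union> X) (K \<union> J) d = 0"
  unfolding sep_sum_def
proof (rule sum.neutral, rule ballI)
  fix R assume R: "R \<in> {R. R \<in> eqrels (W \<union> X) \<and> R \<inter> W \<times> W = Id_on W}"
  have "(x, y) \<in> (ustep d (K - P))\<^sup>*"
    using assms conn_sym by (fastforce simp: component_def)
  then have "(x, y) \<in> (ustep d (K \<union> J - P))\<^sup>*" by (rule conn_mono) auto
  then have "(R `` {x}, R `` {y}) \<in> (ustep (relabel (\<lambda>x. R `` {x}) \<circ> d) (K \<union> J - P))\<^sup>*"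
    by (rule conn_relabel)
  then show "quot_weight \<kappa> (W \<union> X) (K \<union> J) d R = 0"
    using pad_ends_separated[of R x y] R assms by auto
qed

text \<open>Relations of nonzero weight are trivial on the part cut off at \<open>w\<close>, so they
  are the relations on the root component together with \<open>X\<close>, extended by the identity.
  Each such quotient has a cut vertex at the class of \<open>w\<close>, and its second factor does
  not depend on the relation.\<close>

lemma sep_sum_cut:
  assumes w: "ends d P \<inter> component W (K - P) d r = {w}"
  defines "W1 \<equiv> component W (K - P) d r" and "K1 \<equiv> component_edges W (K - P) d r"
  shows "sep_sum \<kappa> W (W \<union> X) (K \<union> J) d =
    weight \<kappa> (W - W1 \<union> {w}) (K - K1) d * sep_sum \<kappa> W1 (W1 \<union> X) (K1 \<union> J) d"
proof -
  let ?V = "W \<union> X" and ?V1 = "W1 \<union> X" and ?V2 = "W - W1 \<union> {w}"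
  let ?I = "K \<union> J" and ?I1 = "K1 \<union> J" and ?I2 = "K - K1"
  have eW: "edges_in W K d" and eX: "edges_in X J d"
    using W X by (simp_all add: connected_graph_def)
  have eW': "edges_in W (K - P) d" using eW by (auto simp: edges_in_def)
  have rW: "r \<in> W" "r \<in> X" using WX by auto
  have rW1: "r \<in> W1" using rW by (simp add: W1_def component_def)
  have W1W: "W1 \<subseteq> W" by (auto simp: W1_def component_def)
  have wW1: "w \<in> W1" using w by (auto simp: W1_def)
  have K1K: "K1 \<subseteq> K - P" by (auto simp: K1_def component_edges_def)
  have V: "?V = ?V1 \<union> ?V2" using W1W wW1 by auto
  have V12: "?V1 \<inter> ?V2 = {w}" using wW1 WX rW1 by auto
  have V1W: "?V1 \<inter> W = W1" using W1W WX rW1 by auto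
  have KJ_split: "?I = ?I1 \<union> ?I2" using K1K by auto
  have conW1: "connected_graph W1 K1 d"
    unfolding W1_def K1_def
    by (rule connected_component) (use W rW eW' in \<open>auto simp: connected_graph_def\<close>)
  have e1: "edges_in ?V1 ?I1 d"
    using conW1 eX by (auto simp: connected_graph_def edges_in_def)
  have e2: "edges_in ?V2 ?I2 d"
    using edges_in_component_complement[OF eW w] unfolding W1_def K1_def .
  let ?A = "{R. R \<in> eqrels ?V \<and> R \<inter> W \<times> W = Id_on W}"
  have split: "R \<subseteq> ?V1 \<times> ?V1 \<union> Id_on ?V2"
    if R: "R \<in> ?A" and nz: "quot_weight \<kappa> ?V ?I d R \<noteq> 0" for R
  proof -
    have Re: "R \<in> eqrels ?V" and Rs: "R \<inter> W \<times> W = Id_on W" using R by auto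
    \<comment> \<open>Off the pad, \<open>y\<close> reaches some pad vertex \<open>v\<close>
      different from \<open>w\<close>, while \<open>x\<close> reaches \<open>w\<close> through the
      root component, using the root if \<open>x\<close> lies in \<open>X\<close>. Merging
      \<open>x\<close> with \<open>y\<close> would connect \<open>v\<close> and \<open>w\<close> off
      the pad.\<close>
    have no: False if xy: "(x, y) \<in> R" and x: "x \<in> ?V1" and y: "y \<in> W" "y \<notin> W1" for x y
    proof -
      let ?q = "\<lambda>x. R `` {x}"
      obtain p where "p \<in> P" using circuit_nonempty[OF P(2)] by auto
      then have s: "esrc (d p) \<in> ends d P" "esrc (d p) \<in> W"
        using joins_self[of "d p"] eW P(1) unfolding ends_def edges_in_def by blast+
      have "(y, esrc (d p)) \<in> (ustep d K)\<^sup>*" using W y s by (simp add: connected_graph_def)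
      then obtain v where v: "v \<in> ends d P" "(y, v) \<in> (ustep d (K - P))\<^sup>*"
        using ends_reachable s(1) by metis
      have "v \<noteq> w"
      proof
        assume "v = w"
        then have "(r, y) \<in> (ustep d (K - P))\<^sup>*"
          using v(2) wW1 conn_sym[OF v(2)] by (auto simp: W1_def component_def)
        then show False using y by (simp add: W1_def component_def)
      qed
      have rw: "(r, w) \<in> (ustep d (K - P))\<^sup>*" using wW1 by (simp add: W1_def component_def)
      have "(x, w) \<in> (ustep d (?I - P))\<^sup>*"
      proof (cases "x \<in> X")
        case True
        then have "(x, r) \<in> (ustep d J)\<^sup>*" using X rW by (simp add: connected_graph_def)
        then have "(x, r) \<in> (ustep d (?I - P))\<^sup>*" by (rule conn_mono) (use KJ P in auto)
        moreover have "(r, w) \<in> (ustep d (?I - P))\<^sup>*" by (rule conn_mono[OF rw]) auto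
        ultimately show ?thesis by simp
      next
        case False
        then have "(r, x) \<in> (ustep d (K - P))\<^sup>*" using x by (simp add: W1_def component_def)
        then have "(x, w) \<in> (ustep d (K - P))\<^sup>*" using rw conn_sym by (metis rtrancl_trans)
        then show ?thesis by (rule conn_mono) auto
      qed
      then have 1: "(?q w, ?q x) \<in> (ustep (relabel ?q \<circ> d) (?I - P))\<^sup>*"
        by (intro conn_sym[OF conn_relabel])
      have "(y, v) \<in> (ustep d (?I - P))\<^sup>*" by (rule conn_mono[OF v(2)]) auto
      then have 2: "(?q y, ?q v) \<in> (ustep (relabel ?q \<circ> d) (?I - P))\<^sup>*" by (rule conn_relabel)
      have "?q x = ?q y" using Re xy by (intro equiv_class_eq[of ?V]) (auto simp: eqrels_def)
      then have "(?q w, ?q v) \<in> (ustep (relabel ?q \<circ> d) (?I - P))\<^sup>*" using 1 2 by simp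
      moreover have "w \<in> ends d P" using w by auto
      ultimately show False using pad_ends_separated[OF Re Rs nz _ v(1)] \<open>v \<noteq> w\<close> by metis
    qed
    show ?thesis
    proof
      fix e assume eR: "e \<in> R"
      then obtain x y where e: "e = (x, y)" "x \<in> ?V" "y \<in> ?V" using eqrels_subset[OF Re] by auto
      show "e \<in> ?V1 \<times> ?V1 \<union> Id_on ?V2"
      proof (cases "x \<in> ?V1")
        case True
        then show ?thesis using no[of x y] eR e by auto
      next
        case False
        then have x: "x \<in> W" "x \<notin> W1" using e by auto
        then have "y \<notin> ?V1" using no[of y x] eR e eqrels_sym[OF Re, of x y] by auto
        then have "(x, y) \<in> Id_on W" using x e eR Rs[symmetric] by auto
        then show ?thesis using x e by auto
      qed
    qed
  qed
  have V2W: "?V2 \<subseteq> W" using W1W wW1 by auto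
  define V1 V2 where "V1 = ?V1" and "V2 = ?V2"
  note folds = V1_def[symmetric] V2_def[symmetric]
  note V = V[unfolded folds] and V12 = V12[unfolded folds] and V1W = V1W[unfolded folds]
    and V2W = V2W[unfolded folds] and e1 = e1[unfolded folds] and e2 = e2[unfolded folds]
    and split = split[unfolded folds]
  have W1V1: "W1 \<subseteq> V1" and wV2: "w \<in> V2" by (auto simp: V1_def V2_def)
  have W12: "Id_on W1 \<union> Id_on V2 = Id_on W" using W1W wW1 by (auto simp: V2_def)
  let ?A2 = "{R \<in> ?A. R \<subseteq> V1 \<times> V1 \<union> Id_on V2}"
  let ?B = "{R. R \<in> eqrels V1 \<and> R \<inter> W1 \<times> W1 = Id_on W1}"
  have fin: "finite ?V" using W X by (simp add: connected_graph_def)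
  have "sep_sum \<kappa> W ?V ?I d = (\<Sum>R\<in>?A2. quot_weight \<kappa> ?V ?I d R)"
    unfolding sep_sum_def
    by (rule sum.mono_neutral_right) (use finite_eqrels[OF fin] split in auto)
  also have "\<dots> = (\<Sum>R\<in>?B. quot_weight \<kappa> ?V ?I d (R \<union> Id_on V2))"
  proof (rule sum.reindex_bij_betw[symmetric], rule bij_betwI[where g = "\<lambda>R. R \<inter> V1 \<times> V1"])
    show "(\<lambda>R. R \<union> Id_on V2) \<in> ?B \<rightarrow> ?A2"
    proof
      fix R assume "R \<in> ?B"
      then have R: "R \<in> eqrels V1" "R \<inter> W1 \<times> W1 = Id_on W1" by auto
      note sub = eqrels_subset[OF R(1)]
      have ext: "R \<union> Id_on V2 \<in> eqrels ?V" using eqrels_extend[OF R(1), of V2] unfolding V .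
      have "R \<inter> W \<times> W = R \<inter> W1 \<times> W1" using sub V1W by blast
      moreover have "(R \<union> Id_on V2) \<inter> W \<times> W = R \<inter> W \<times> W \<union> Id_on V2" using V2W by auto
      ultimately have "(R \<union> Id_on V2) \<inter> W \<times> W = Id_on W" using R(2) W12 by simp
      moreover have "R \<union> Id_on V2 \<subseteq> V1 \<times> V1 \<union> Id_on V2" using sub by (intro Un_mono) simp_all
      ultimately show "R \<union> Id_on V2 \<in> ?A2" using ext by (intro CollectI conjI)
    qed
    show "(\<lambda>R. R \<inter> V1 \<times> V1) \<in> ?A2 \<rightarrow> ?B"
    proof
      fix R assume "R \<in> ?A2"
      then have R: "R \<in> eqrels ?V" "R \<inter> W \<times> W = Id_on W" by auto
      have "R \<inter> V1 \<times> V1 \<in> eqrels V1" by (rule eqrels_restrict[OF R(1)]) (simp add: V)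
      moreover have "(R \<inter> V1 \<times> V1) \<inter> W1 \<times> W1 = (R \<inter> W \<times> W) \<inter> W1 \<times> W1" using W1W W1V1 by blast
      then have "(R \<inter> V1 \<times> V1) \<inter> W1 \<times> W1 = Id_on W1" using R(2) W1W by auto
      ultimately show "R \<inter> V1 \<times> V1 \<in> ?B" by (intro CollectI conjI)
    qed
    fix R assume "R \<in> ?B"
    then have R: "R \<in> eqrels V1" by simp
    show "(R \<union> Id_on V2) \<inter> V1 \<times> V1 = R"
      using eqrels_subset[OF R] eqrels_refl[OF R] by blast
  next
    fix R assume "R \<in> ?A2"
    then have R: "R \<in> eqrels ?V" "R \<subseteq> V1 \<times> V1 \<union> Id_on V2" by auto
    have "(x, x) \<in> R" if "x \<in> V2" for x using eqrels_refl[OF R(1)] that V by blast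
    then show "R \<inter> V1 \<times> V1 \<union> Id_on V2 = R" using R(2) by blast
  qed
  also have "\<dots> = (\<Sum>R\<in>?B. weight \<kappa> V2 ?I2 d * quot_weight \<kappa> V1 ?I1 d R)"
  proof (rule sum.cong)
    fix R assume "R \<in> ?B"
    then have R: "R \<in> eqrels V1" "R \<inter> W1 \<times> W1 = Id_on W1" by auto
    let ?R = "R \<union> Id_on V2"
    let ?q = "\<lambda>x. ?R `` {x}"
    note sub = eqrels_subset[OF R(1)]
    have Re: "?R \<in> eqrels ?V" using eqrels_extend[OF R(1), of V2] unfolding V .
    have q: "?q x = ?q y \<longleftrightarrow> (x, y) \<in> ?R" if "x \<in> ?V" "y \<in> ?V" for x y
      using eq_equiv_class_iff[of ?V ?R x y] Re that by (simp add: eqrels_def)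
    have q2: "x = y" if "?q x = ?q y" "x \<in> V2" "y \<in> V2" for x y
    proof -
      have "(x, y) \<in> ?R" using q[of x y] that V by simp
      then show ?thesis
      proof
        assume "(x, y) \<in> R"
        then have "x \<in> V1 \<inter> V2" "y \<in> V1 \<inter> V2" using that sub by blast+
        then show ?thesis unfolding V12 by simp
      qed auto
    qed
    \<comment> \<open>Every vertex of \<open>V2\<close> other than \<open>w\<close> is alone in its
      class, so only the class of \<open>w\<close> can be common to both sides.\<close>
    have cut: "?q ` V1 \<inter> ?q ` V2 = {?q w}"
    proof
      show "{?q w} \<subseteq> ?q ` V1 \<inter> ?q ` V2" using wW1 W1V1 wV2 by blast
      show "?q ` V1 \<inter> ?q ` V2 \<subseteq> {?q w}"
      proof
        fix c assume "c \<in> ?q ` V1 \<inter> ?q ` V2"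
        then obtain x y where xy: "x \<in> V1" "y \<in> V2" "c = ?q x" "c = ?q y" by blast
        then have "(x, y) \<in> ?R" using q[of x y] V by simp
        then have "y \<in> V1" using sub xy(1) by blast
        then have "y = w" using V12 xy by blast
        then show "c \<in> {?q w}" using xy by simp
      qed
    qed
    interpret cv: cut_vertex "?q ` V1" "?q ` V2" ?I1 ?I2 "relabel ?q \<circ> d" "?q w"
      using cut K1K KJ edges_in_relabel[OF e1, of ?q] edges_in_relabel[OF e2, of ?q]
      by unfold_locales auto
    have "quot_weight \<kappa> ?V ?I d ?R = weight \<kappa> (?q ` V1 \<union> ?q ` V2) (?I1 \<union> ?I2) (relabel ?q \<circ> d)"
      unfolding quot_weight_def V KJ_split image_Un ..
    also have "\<dots> = weight \<kappa> (?q ` V1) ?I1 (relabel ?q \<circ> d) * weight \<kappa> (?q ` V2) ?I2 (relabel ?q \<circ> d)"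
      by (rule cv.weight_cut_vertex) (use KJ K1K in \<open>auto intro: finite_subset\<close>)
    also have "weight \<kappa> (?q ` V1) ?I1 (relabel ?q \<circ> d) = quot_weight \<kappa> V1 ?I1 d R"
    proof (rule quot_weight_kernel[OF R(1) e1, symmetric])
      fix x y assume xy: "x \<in> V1" "y \<in> V1"
      then have "(x, y) \<in> ?R \<longleftrightarrow> (x, y) \<in> R" using eqrels_refl[OF R(1)] by blast
      then show "?q x = ?q y \<longleftrightarrow> (x, y) \<in> R" using q[of x y] xy V by simp
    qed
    \<comment> \<open>The vertex \<open>w\<close> may be merged with vertices of \<open>X\<close>,
      but no two vertices of \<open>V2\<close> are merged; up to naming, this side is not quotiented
      at all.\<close>
    also have "weight \<kappa> (?q ` V2) ?I2 (relabel ?q \<circ> d) = weight \<kappa> V2 ?I2 d"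
      by (rule weight_iso[where h = id and f = ?q]) (use q2 e2 in \<open>auto simp: inj_on_def\<close>)
    finally show "quot_weight \<kappa> ?V ?I d ?R = weight \<kappa> V2 ?I2 d * quot_weight \<kappa> V1 ?I1 d R"
      by (simp add: mult.commute)
  qed simp
  finally show ?thesis unfolding sep_sum_def sum_distrib_left V1_def V2_def .
qed

end

end

section \<open>Graph monomials glued at the root\<close>

lemma connected_graph_image:
  assumes c: "connected_graph V J d'" and d: "\<And>j. j \<in> J \<Longrightarrow> d (h j) = relabel f (d' j)"
  shows "connected_graph (f ` V) (h ` J) d"
proof -
  have "(f x, f y) \<in> (ustep d (h ` J))\<^sup>*" if xy: "x \<in> V" "y \<in> V" for x y
  proof (rule conn_map[of x y d' J f])
    show "(x, y) \<in> (ustep d' J)\<^sup>*" using c xy by (simp add: connected_graph_def)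
    fix i u v assume "i \<in> J" "joins (d' i) u v"
    then show "(f u, f v) \<in> (ustep d (h ` J))\<^sup>*"
      using d[of i] joins_relabel[of "d' i" u v f] by (intro conn_joins[of "h i"]) auto
  qed
  then show ?thesis using c d by (auto simp: connected_graph_def edges_in_def)
qed

text \<open>The closure of \<open>t u\<close> is \<open>t\<close> (with both roots at \<open>r\<close>) together with \<open>u\<close>, whose two roots both become \<open>r\<close>.\<close>

definition glue_map :: "nat \<Rightarrow> 'a gmon \<Rightarrow> nat \<Rightarrow> nat + nat" where
  "glue_map r u v = (if v = gin u \<or> v = gout u then Inl r else Inr v)"

definition glue_verts :: "'a gmon \<Rightarrow> 'a gmon \<Rightarrow> (nat + nat) set" where
  "glue_verts t u = Inl ` gV t \<union> glue_map (gin t) u ` gV u"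

text \<open>The sum type keeps the edges of \<open>t\<close> and \<open>u\<close> apart without
  shifting positions, so replacing \<open>t\<close> leaves the names of the edges of
  \<open>u\<close> unchanged.\<close>

definition glue_indices :: "'a gmon \<Rightarrow> 'a gmon \<Rightarrow> (nat + nat) set" where
  "glue_indices t u = Inl ` {..<length (gE t)} \<union> Inr ` {..<length (gE u)}"

definition glue_edge :: "'a gmon \<Rightarrow> 'a gmon \<Rightarrow> nat + nat \<Rightarrow> (nat + nat) \<times> (nat + nat) \<times> 'a" where
  "glue_edge t u = case_sum (\<lambda>i. relabel Inl (gE t ! i)) (\<lambda>j. relabel (glue_map (gin t) u) (gE u ! j))"

lemma glue_edge_simps [simp]:
  "glue_edge t u (Inl i) = relabel Inl (gE t ! i)"
  "glue_edge t u (Inr j) = relabel (glue_map (gin t) u) (gE u ! j)"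
  by (simp_all add: glue_edge_def)

text \<open>This is the functional \<open>G\<close> of the overview.\<close>

definition inj_functional :: "('a list \<Rightarrow> complex) \<Rightarrow> 'a gmon \<Rightarrow> 'a gmon \<Rightarrow> complex" where
  "inj_functional \<kappa> t u = sep_sum \<kappa> (Inl ` gV t) (glue_verts t u) (glue_indices t u) (glue_edge t u)"

lemma wf_gm_connected: "wf_gm g \<Longrightarrow> connected_graph (gV g) {..<length (gE g)} ((!) (gE g))"
  by (simp add: wf_gm_def connected_mg_iff)

lemma wf_gm_edges: "wf_gm g \<Longrightarrow> i < length (gE g) \<Longrightarrow> esrc (gE g ! i) \<in> gV g \<and> etgt (gE g ! i) \<in> gV g"
  using wf_gm_connected[of g] by (simp add: connected_graph_def edges_in_def)

lemma wf_gm_finite: "wf_gm g \<Longrightarrow> finite (gV g)"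
  using wf_gm_connected[of g] by (simp add: connected_graph_def)

lemma finite_glue: "wf_gm t \<Longrightarrow> wf_gm u \<Longrightarrow> finite (glue_verts t u)"
  by (simp add: glue_verts_def wf_gm_finite)

lemma edges_in_glue:
  assumes "wf_gm t" "wf_gm u"
  shows "edges_in (glue_verts t u) (glue_indices t u) (glue_edge t u)"
  using wf_gm_edges[OF assms(1)] wf_gm_edges[OF assms(2)]
  by (auto simp: edges_in_def glue_indices_def glue_verts_def)

section \<open>Quotients of graph monomials\<close>

definition quot_rep :: "(nat \<times> nat) set \<Rightarrow> nat \<Rightarrow> nat" where
  "quot_rep \<rho> x = (LEAST y. (x, y) \<in> \<rho>)"

text \<open>Least elements serve as class representatives. The quotient is thus again a monomial on
  natural numbers, and the discrete relation returns \<open>t\<close> itself and not merely an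
  isomorphic copy.\<close>

definition quot_gm :: "'a gmon \<Rightarrow> (nat \<times> nat) set \<Rightarrow> 'a gmon" where
  "quot_gm t \<rho> = \<lparr>gV = quot_rep \<rho> ` gV t, gE = map (relabel (quot_rep \<rho>)) (gE t),
     gin = quot_rep \<rho> (gin t), gout = quot_rep \<rho> (gout t)\<rparr>"

lemma quot_gm_sel [simp]:
  "gV (quot_gm t \<rho>) = quot_rep \<rho> ` gV t" "gE (quot_gm t \<rho>) = map (relabel (quot_rep \<rho>)) (gE t)"
  "gin (quot_gm t \<rho>) = quot_rep \<rho> (gin t)" "gout (quot_gm t \<rho>) = quot_rep \<rho> (gout t)"
  by (simp_all add: quot_gm_def)

lemma quot_rep_eq_iff:
  assumes "\<rho> \<in> eqrels V" "x \<in> V" "y \<in> V"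
  shows "quot_rep \<rho> x = quot_rep \<rho> y \<longleftrightarrow> (x, y) \<in> \<rho>"
proof
  have rep: "(z, quot_rep \<rho> z) \<in> \<rho>" if "z \<in> V" for z
    unfolding quot_rep_def using eqrels_refl[OF assms(1) that] by (rule LeastI)
  assume "quot_rep \<rho> x = quot_rep \<rho> y"
  then show "(x, y) \<in> \<rho>"
    using rep[OF assms(2)] rep[OF assms(3)] eqrels_sym[OF assms(1)] eqrels_trans[OF assms(1)] by metis
next
  assume xy: "(x, y) \<in> \<rho>"
  have "(x, z) \<in> \<rho> \<longleftrightarrow> (y, z) \<in> \<rho>" for z
    using xy eqrels_sym[OF assms(1)] eqrels_trans[OF assms(1)] by metis
  then show "quot_rep \<rho> x = quot_rep \<rho> y" by (simp add: quot_rep_def)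
qed

lemma quot_gm_Id:
  assumes "wf_gm t"
  shows "quot_gm t (Id_on (gV t)) = t"
proof -
  have rep: "quot_rep (Id_on (gV t)) x = x" if "x \<in> gV t" for x
    unfolding quot_rep_def by (rule Least_equality) (use that in auto)
  have "relabel (quot_rep (Id_on (gV t))) e = e" if "e \<in> set (gE t)" for e
  proof -
    have "esrc e \<in> gV t" "etgt e \<in> gV t" using that wf_gm_edges[OF assms] by (auto simp: in_set_conv_nth)
    then show ?thesis by (simp add: relabel_def rep) (simp add: esrc_def etgt_def elab_def)
  qed
  then have "map (relabel (quot_rep (Id_on (gV t)))) (gE t) = gE t" by (simp add: map_idI)
  moreover have "quot_rep (Id_on (gV t)) ` gV t = gV t" using rep by auto
  moreover have "gin t \<in> gV t" "gout t \<in> gV t" using assms by (auto simp: wf_gm_def)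
  ultimately show ?thesis using rep by (simp add: quot_gm_def)
qed

lemma wf_quot_gm:
  assumes "wf_gm t"
  shows "wf_gm (quot_gm t \<rho>)"
proof -
  have "connected_graph (quot_rep \<rho> ` gV t) (id ` {..<length (gE t)})
      ((!) (map (relabel (quot_rep \<rho>)) (gE t)))"
    by (rule connected_graph_image[OF wf_gm_connected[OF assms]]) simp
  then show ?thesis using assms by (auto simp: wf_gm_def connected_mg_iff)
qed

lemma card_quot_gm_less:
  assumes "finite (gV t)" "\<rho> \<in> eqrels (gV t)" "\<rho> \<noteq> Id_on (gV t)"
  shows "card (gV (quot_gm t \<rho>)) < card (gV t)"
proof -
  have "\<not> inj_on (quot_rep \<rho>) (gV t)"
  proof
    assume inj: "inj_on (quot_rep \<rho>) (gV t)"
    have "x = y" if "(x, y) \<in> \<rho>" for x y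
      using that eqrels_subset[OF assms(2)] quot_rep_eq_iff[OF assms(2), of x y] inj_onD[OF inj, of x y]
      by auto
    then have "\<rho> = Id_on (gV t)" using eqrels_subset[OF assms(2)] eqrels_refl[OF assms(2)] by auto
    then show False using assms(3) by simp
  qed
  then have "card (quot_rep \<rho> ` gV t) \<noteq> card (gV t)" using eq_card_imp_inj_on assms(1) by blast
  then show ?thesis using card_image_le[OF assms(1), of "quot_rep \<rho>"] by simp
qed

context cyclic_cumulants
begin

text \<open>Compares the concrete product, with its shifted vertices and concatenated edge list, to
  the glued graph. The map \<open>F\<close> on vertices and \<open>h\<close> on edge positions form
  an isomorphism from the glued graph to the closed product.\<close>

lemma psi_gm_gmul_eq:
  assumes t: "wf_gm t" "gin t = gout t" and u: "wf_gm u"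
  shows "psi_gm \<kappa> (gmul t u) = sep_sum \<kappa> {} (glue_verts t u) (glue_indices t u) (glue_edge t u)"
proof -
  let ?r = "gin t" and ?g = "gmul t u"
  define s where "s = Suc (Max (insert 0 (gV t)))"
  define f where "f v = (if v = gout u then ?r else v + s)" for v
  define fr where "fr = f (gin u)"
  \<comment> \<open>Closing replaces the output \<open>?r\<close> of the product by its input
    \<open>fr\<close>, so the common root of the glued graph must be sent to
    \<open>fr\<close>.\<close>
  define F where "F = case_sum (\<lambda>v. if v = ?r then fr else v) (\<lambda>v. v + s)"
  have g: "gV ?g = gV t \<union> f ` gV u" "gE ?g = gE t @ map (relabel f) (gE u)" "gin ?g = fr" "gout ?g = ?r"
  proof -
    have "f = (\<lambda>v. if v = gout u then ?r else v + Suc (Max (insert 0 (gV t))))"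
      by (simp add: fun_eq_iff f_def s_def)
    then show "gV ?g = gV t \<union> f ` gV u" "gE ?g = gE t @ map (relabel f) (gE u)" "gin ?g = fr" "gout ?g = ?r"
      by (simp_all add: gmul_def Let_def fr_def relabel_case t(2))
  qed
  have small: "v < s" if "v \<in> gV t" for v
    unfolding s_def using that wf_gm_finite[OF t(1)] by (simp add: le_imp_less_Suc)
  have rV: "?r \<in> gV t" using t by (simp add: wf_gm_def)
  have c1: "close_map ?g v = F (Inl v)" for v
    by (simp add: close_map_def g F_def)
  have c2: "close_map ?g (f v) = F (glue_map ?r u v)" for v
    using small[OF rV] by (auto simp: close_map_def g F_def glue_map_def fr_def f_def)
  have C1: "close_map ?g = F \<circ> Inl" and C2: "close_map ?g \<circ> f = F \<circ> glue_map ?r u"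
    using c1 c2 by (auto simp: fun_eq_iff)
  have inj: "inj_on F (glue_verts t u)"
  proof -
    have "x = y" if "x \<in> glue_verts t u" "y \<in> glue_verts t u" "F x = F y" for x y
      using that small rV
      by (auto simp: glue_verts_def glue_map_def F_def fr_def f_def split: if_splits)
         (metis not_add_less2)+
    then show ?thesis by (auto simp: inj_on_def)
  qed
  let ?E = "map (\<lambda>(x, y, a). (close_map ?g x, close_map ?g y, a)) (gE ?g)"
  let ?n = "length (gE t)"
  define h where "h = case_sum (\<lambda>i. i) (\<lambda>j. ?n + j)"
  have E: "?E = map (relabel (F \<circ> Inl)) (gE t) @ map (relabel (F \<circ> glue_map ?r u)) (gE u)"
    unfolding relabel_case g(2) C1[symmetric] C2[symmetric] by (simp add: relabel_relabel)
  have lenE: "length ?E = ?n + length (gE u)" by (simp add: g)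
  have hbij: "bij_betw h (glue_indices t u) {..<length ?E}"
    unfolding lenE bij_betw_def
  proof
    show "inj_on h (glue_indices t u)"
      by (auto simp: inj_on_def glue_indices_def h_def)
    show "h ` glue_indices t u = {..<?n + length (gE u)}"
    proof
      show "{..<?n + length (gE u)} \<subseteq> h ` glue_indices t u"
      proof
        fix i assume i: "i \<in> {..<?n + length (gE u)}"
        show "i \<in> h ` glue_indices t u"
        proof (cases "i < ?n")
          case True
          then show ?thesis by (intro image_eqI[of _ _ "Inl i"]) (auto simp: h_def glue_indices_def)
        next
          case False
          then show ?thesis using i
            by (intro image_eqI[of _ _ "Inr (i - ?n)"]) (auto simp: h_def glue_indices_def)
        qed
      qed
    qed (auto simp: h_def glue_indices_def)
  qed
  have Ed: "?E ! h j = relabel F (glue_edge t u j)" if "j \<in> glue_indices t u" for j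
    using that unfolding E
    by (auto simp: glue_indices_def h_def nth_append relabel_relabel)
  have V: "close_map ?g ` gV ?g = F ` glue_verts t u"
  proof -
    have "close_map ?g ` gV t = F ` Inl ` gV t" by (simp only: C1 image_comp)
    moreover have "close_map ?g ` f ` gV u = F ` glue_map ?r u ` gV u" by (simp only: image_comp C2)
    ultimately show ?thesis by (simp only: g(1) glue_verts_def image_Un)
  qed
  have "edges_in (F ` glue_verts t u) {..<length ?E} ((!) ?E)"
  proof -
    have "edges_in (F ` glue_verts t u) (h ` glue_indices t u) ((!) ?E)"
      using Ed edges_in_glue[OF t(1) u] by (auto simp: edges_in_def)
    then show ?thesis using hbij by (simp add: bij_betw_def)
  qed
  then have "psi_gm \<kappa> ?g = sep_sum \<kappa> {} (F ` glue_verts t u) {..<length ?E} ((!) ?E)"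
    unfolding psi_gm_def V by (rule tau_eq_sum) (simp add: finite_glue t u)
  also have "\<dots> = sep_sum \<kappa> {} (glue_verts t u) (glue_indices t u) (glue_edge t u)"
    using sep_sum_pullback[OF hbij Ed edges_in_glue[OF t(1) u], of "{}"] inj
    by (simp add: inj_on_def sep_sum_def)
  finally show ?thesis .
qed

text \<open>Relations on the glued graph are grouped by their trace \<rho> on the vertices of
  \<open>t\<close>. Collapsing \<open>t\<close> along \<rho> turns each group into a sum over
  relations that separate the vertices of the quotient.\<close>

lemma psi_gm_gmul_sum:
  assumes t: "wf_gm t" "gin t = gout t" and u: "wf_gm u"
  shows "psi_gm \<kappa> (gmul t u) = (\<Sum>\<rho>\<in>eqrels (gV t). inj_functional \<kappa> (quot_gm t \<rho>) u)"
proof -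
  let ?V = "glue_verts t u" and ?I = "glue_indices t u" and ?d = "glue_edge t u"
  let ?W = "Inl ` gV t :: (nat + nat) set"
  have W: "?W \<subseteq> ?V" by (auto simp: glue_verts_def)
  define res where "res R = {(x, y). x \<in> gV t \<and> y \<in> gV t \<and> (Inl x, Inl y) \<in> R}" for R :: "((nat + nat) \<times> (nat + nat)) set"
  have res: "res R \<in> eqrels (gV t)" if R: "R \<in> eqrels ?V" for R
  proof (rule eqrelsI)
    show "(x, x) \<in> res R" if "x \<in> gV t" for x using eqrels_refl[OF R, of "Inl x"] that W by (auto simp: res_def)
    show "(y, x) \<in> res R" if "(x, y) \<in> res R" for x y using eqrels_sym[OF R] that by (simp add: res_def)
    show "(x, z) \<in> res R" if "(x, y) \<in> res R" "(y, z) \<in> res R" for x y z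
      using eqrels_trans[OF R, of "Inl x" "Inl y"] that by (simp add: res_def)
  qed (auto simp: res_def)
  have "psi_gm \<kappa> (gmul t u) = (\<Sum>R\<in>eqrels ?V. quot_weight \<kappa> ?V ?I ?d R)"
    by (simp add: psi_gm_gmul_eq[OF assms] sep_sum_def)
  also have "\<dots> = (\<Sum>\<rho>\<in>eqrels (gV t). \<Sum>R | R \<in> eqrels ?V \<and> res R = \<rho>. quot_weight \<kappa> ?V ?I ?d R)"
    by (rule sum.group[symmetric])
       (use res finite_eqrels[OF finite_glue[OF t(1) u]] finite_eqrels[OF wf_gm_finite[OF t(1)]] in auto)
  also have "\<dots> = (\<Sum>\<rho>\<in>eqrels (gV t). inj_functional \<kappa> (quot_gm t \<rho>) u)"
  proof (rule sum.cong)
    fix \<rho> assume \<rho>: "\<rho> \<in> eqrels (gV t)"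
    define q where "q = map_sum (quot_rep \<rho>) (\<lambda>v :: nat. v)"
    have qW: "q ` ?W = Inl ` gV (quot_gm t \<rho>)" by (simp add: q_def image_image)
    have qg: "q \<circ> glue_map (gin t) u = glue_map (gin (quot_gm t \<rho>)) u"
      by (auto simp: q_def glue_map_def fun_eq_iff)
    have qV: "q ` ?V = glue_verts (quot_gm t \<rho>) u"
      unfolding glue_verts_def image_Un qW by (simp only: image_comp qg)
    have I: "glue_indices (quot_gm t \<rho>) u = ?I" by (simp add: glue_indices_def)
    have d: "glue_edge (quot_gm t \<rho>) u (id j) = relabel q (?d j)" if "j \<in> ?I" for j
    proof (cases j)
      case (Inl i)
      then show ?thesis using that by (auto simp: glue_indices_def relabel_relabel comp_def q_def)
    next
      case (Inr i)
      then show ?thesis using qg by (simp add: relabel_relabel)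
    qed
    have res_iff: "res R = \<rho> \<longleftrightarrow> R \<inter> ?W \<times> ?W = {(x, y). x \<in> ?W \<and> y \<in> ?W \<and> q x = q y}" (is "_ \<longleftrightarrow> ?rhs") for R
    proof -
      have "?rhs \<longleftrightarrow> (\<forall>a\<in>?W. \<forall>b\<in>?W. (a, b) \<in> R \<longleftrightarrow> q a = q b)" by blast
      also have "\<dots> \<longleftrightarrow> (\<forall>x\<in>gV t. \<forall>y\<in>gV t. (Inl x, Inl y) \<in> R \<longleftrightarrow> quot_rep \<rho> x = quot_rep \<rho> y)"
        by (simp add: q_def)
      also have "\<dots> \<longleftrightarrow> (\<forall>x\<in>gV t. \<forall>y\<in>gV t. (x, y) \<in> res R \<longleftrightarrow> (x, y) \<in> \<rho>)"
        using quot_rep_eq_iff[OF \<rho>] by (simp add: res_def)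
      also have "\<dots> \<longleftrightarrow> res R = \<rho>"
        using eqrels_subset[OF \<rho>] by (auto simp: set_eq_iff res_def)
      finally show ?thesis by simp
    qed
    have "(\<Sum>R | R \<in> eqrels ?V \<and> res R = \<rho>. quot_weight \<kappa> ?V ?I ?d R) =
        sep_sum \<kappa> (q ` ?W) (q ` ?V) ?I (glue_edge (quot_gm t \<rho>) u)"
      unfolding res_iff
    proof (rule sep_sum_pullback[where h = id, OF _ _ edges_in_glue[OF t(1) u] W])
      show "glue_edge (quot_gm t \<rho>) u (id j) = relabel q (?d j)" if "j \<in> ?I" for j
        using that by (rule d)
      \<comment> \<open>Vertices of \<open>u\<close> tagged \<open>Inr\<close> are fixed by
        \<open>q\<close>, and the only other vertex coming from \<open>u\<close> is the root, which
        belongs to \<open>t\<close>. So \<open>q\<close> identifies vertices of \<open>t\<close>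
        only.\<close>
      fix x y assume "x \<in> ?V" "y \<in> ?V" "q x = q y"
      then show "x = y \<or> x \<in> ?W \<and> y \<in> ?W"
        using t by (cases x; cases y) (auto simp: q_def glue_verts_def glue_map_def wf_gm_def split: if_splits)
    qed simp
    then show "(\<Sum>R | R \<in> eqrels ?V \<and> res R = \<rho>. quot_weight \<kappa> ?V ?I ?d R) =
        inj_functional \<kappa> (quot_gm t \<rho>) u"
      by (simp only: inj_functional_def qW qV I)
  qed simp
  finally show ?thesis .
qed

end

section \<open>Reduction to trees\<close>

lemma relabel_id [simp]: "relabel id e = e"
  by (simp add: relabel_def esrc_def etgt_def elab_def)

lemma ends_eq: "ends d P = (\<lambda>i. esrc (d i)) ` P \<union> (\<lambda>i. etgt (d i)) ` P"
  by (auto simp: ends_def joins_def)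

text \<open>A walk from the root to the cycle, stopped at its first vertex on the cycle, stays in
  the root component. Hence only one or several such vertices need to be considered.\<close>

lemma ends_component_nonempty:
  assumes c: "connected_graph V K d" and r: "r \<in> V" and P: "P \<subseteq> K" "P \<noteq> {}"
  shows "ends d P \<inter> component V (K - P) d r \<noteq> {}"
proof -
  obtain p where p: "p \<in> P" using P by auto
  have e: "edges_in V K d" using c by (simp add: connected_graph_def)
  have "esrc (d p) \<in> V" using e p P by (auto simp: edges_in_def)
  then have "(r, esrc (d p)) \<in> (ustep d K)\<^sup>*" using c r by (simp add: connected_graph_def)
  moreover have "esrc (d p) \<in> ends d P" using p by (auto simp: ends_eq)
  ultimately obtain v where v: "v \<in> ends d P" "(r, v) \<in> (ustep d (K - P))\<^sup>*"
    using ends_reachable by metis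
  moreover have "v \<in> V" using v(1) e P by (auto simp: ends_eq edges_in_def)
  ultimately show ?thesis by (auto simp: component_def)
qed

section \<open>The copy of \<open>t\<close> inside the glued graph\<close>

lemma conn_glue_Inl:
  "(Inl x, Inl y) \<in> (ustep (glue_edge t u) (Inl ` D))\<^sup>* \<longleftrightarrow> (x, y) \<in> (ustep ((!) (gE t)) D)\<^sup>*"
proof
  assume a: "(Inl x, Inl y) \<in> (ustep (glue_edge t u) (Inl ` D))\<^sup>*"
  have "(projl (Inl x :: nat + nat), projl (Inl y :: nat + nat)) \<in> (ustep ((!) (gE t)) D)\<^sup>*"
  proof (rule conn_map[where f = projl, OF a])
    fix i v w assume "i \<in> Inl ` D" "joins (glue_edge t u i) v w"
    then obtain j where "j \<in> D" "joins (relabel Inl (gE t ! j)) v w" by auto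
    then show "(projl v, projl w) \<in> (ustep ((!) (gE t)) D)\<^sup>*"
      by (intro conn_joins[of j]) (auto simp: joins_def)
  qed
  then show "(x, y) \<in> (ustep ((!) (gE t)) D)\<^sup>*" by simp
next
  assume a: "(x, y) \<in> (ustep ((!) (gE t)) D)\<^sup>*"
  show "(Inl x, Inl y) \<in> (ustep (glue_edge t u) (Inl ` D))\<^sup>*"
  proof (rule conn_map[where f = Inl, OF a])
    fix i v w assume "i \<in> D" "joins (gE t ! i) v w"
    then show "(Inl v, Inl w) \<in> (ustep (glue_edge t u) (Inl ` D))\<^sup>*"
      using joins_relabel[of "gE t ! i" v w Inl] by (intro conn_joins[of "Inl i"]) auto
  qed
qed

lemma component_glue_Inl:
  "component (Inl ` V) (Inl ` K) (glue_edge t u) (Inl r) = Inl ` component V K ((!) (gE t)) r"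
  by (auto simp: component_def conn_glue_Inl)

lemma component_edges_glue_Inl:
  "component_edges (Inl ` V) (Inl ` K) (glue_edge t u) (Inl r) = Inl ` component_edges V K ((!) (gE t)) r"
  unfolding component_edges_def component_glue_Inl by auto

lemma ends_glue_Inl: "ends (glue_edge t u) (Inl ` P) = Inl ` ends ((!) (gE t)) P"
  by (simp add: ends_eq image_Un image_image)

text \<open>Listing \<open>K\<close> in increasing order turns a set of edge positions back into an
  edge list. Both roots sit at the root of \<open>t\<close>.\<close>

definition subgraph_gm :: "'a gmon \<Rightarrow> nat set \<Rightarrow> nat set \<Rightarrow> 'a gmon" where
  "subgraph_gm t V K = \<lparr>gV = V, gE = map ((!) (gE t)) (sorted_list_of_set K), gin = gin t, gout = gin t\<rparr>"

lemma subgraph_gm_sel [simp]: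
  "gV (subgraph_gm t V K) = V" "gE (subgraph_gm t V K) = map ((!) (gE t)) (sorted_list_of_set K)"
  "gin (subgraph_gm t V K) = gin t" "gout (subgraph_gm t V K) = gin t"
  by (simp_all add: subgraph_gm_def)

lemma bij_sorted_list_of_set:
  "finite K \<Longrightarrow> bij_betw ((!) (sorted_list_of_set K)) {..<card K} K"
  by (rule bij_betw_nth) simp_all

lemma wf_subgraph_gm:
  assumes c: "connected_graph V K ((!) (gE t))" and K: "finite K" and r: "gin t \<in> V"
  shows "wf_gm (subgraph_gm t V K)"
proof -
  let ?g = "(!) (sorted_list_of_set K)" and ?E = "gE (subgraph_gm t V K)"
  define h where "h = inv_into {..<card K} ?g"
  have b: "bij_betw ?g {..<card K} K" by (rule bij_sorted_list_of_set[OF K])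
  have hb: "h ` K = {..<card K}" using bij_betw_inv_into[OF b] by (simp add: bij_betw_def h_def)
  have "?g (h j) = j" if "j \<in> K" for j using bij_betw_inv_into_right[OF b that] by (simp add: h_def)
  moreover have "h j < card K" if "j \<in> K" for j using hb that by auto
  ultimately have E: "?E ! h j = relabel id (gE t ! j)" if "j \<in> K" for j using that K by simp
  have "connected_graph (id ` V) (h ` K) ((!) ?E)"
    by (rule connected_graph_image[OF c]) (rule E)
  then have "connected_graph V {..<card K} ((!) ?E)"
    unfolding hb by simp
  then show ?thesis using r K by (simp add: wf_gm_def connected_mg_iff)
qed

context cyclic_cumulants
begin

text \<open>Vertices of \<open>t\<close> are kept apart here, so a cycle of \<open>t\<close> survives as a pad, and the rest of
  the cactus hangs off its vertices. Only the part at the root sees \<open>u\<close>.\<close>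
lemma inj_functional_remove_circuit:
  assumes t: "wf_gm t" "gin t = gout t"
    and P: "P \<subseteq> {..<length (gE t)}" "circuit ((!) (gE t)) P"
  shows "\<exists>c t'. wf_gm t' \<and> gin t' = gout t' \<and> length (gE t') < length (gE t) \<and>
    card (gV t') \<le> card (gV t) \<and> (\<forall>u. wf_gm u \<longrightarrow> inj_functional \<kappa> t u = c * inj_functional \<kappa> t' u)"
proof -
  let ?n = "length (gE t)" and ?e = "(!) (gE t)" and ?r = "gin t"
  define C where "C = component (gV t) ({..<?n} - P) ?e ?r"
  define K where "K = component_edges (gV t) ({..<?n} - P) ?e ?r"
  define t' where "t' = subgraph_gm t C K"
  have con: "connected_graph (gV t) {..<?n} ?e" by (rule wf_gm_connected[OF t(1)])
  have r: "?r \<in> gV t" using t by (simp add: wf_gm_def)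
  have ein: "edges_in (gV t) {..<?n} ?e" using con by (simp add: connected_graph_def)
  have K: "K \<subseteq> {..<?n} - P" by (auto simp: K_def component_edges_def)
  have finK: "finite K" using K by (rule finite_subset) simp
  have CV: "C \<subseteq> gV t" and rC: "?r \<in> C" using r by (auto simp: C_def component_def)
  have "connected_graph C K ?e"
    unfolding C_def K_def
    by (rule connected_component) (use ein wf_gm_finite[OF t(1)] r in \<open>auto simp: edges_in_def\<close>)
  then have wf': "wf_gm t'" unfolding t'_def by (rule wf_subgraph_gm[OF _ finK rC])
  have "card K < card {..<?n}"
    using K P circuit_nonempty[OF P(2)] by (intro psubset_card_mono) auto
  then have len: "length (gE t') < ?n" using finK by (simp add: t'_def)
  have crd: "card (gV t') \<le> card (gV t)"
    using CV wf_gm_finite[OF t(1)] by (simp add: t'_def card_mono)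
  have ne: "ends ?e P \<inter> C \<noteq> {}"
    unfolding C_def by (rule ends_component_nonempty[OF con r P(1) circuit_nonempty[OF P(2)]])
  have glue: "connected_graph (Inl ` gV t) (Inl ` {..<?n}) (glue_edge t u)"
      "connected_graph (glue_map ?r u ` gV u) (Inr ` {..<length (gE u)}) (glue_edge t u)"
      "Inl ` gV t \<inter> glue_map ?r u ` gV u = {Inl ?r}"
      "Inl ` {..<?n} \<inter> Inr ` {..<length (gE u)} = {}"
      "finite (Inl ` {..<?n} :: (nat + nat) set)" "finite (Inr ` {..<length (gE u)} :: (nat + nat) set)"
      "Inl ` P \<subseteq> Inl ` {..<?n}" "circuit (glue_edge t u) (Inl ` P)" if u: "wf_gm u" for u
  proof -
    show "connected_graph (Inl ` gV t) (Inl ` {..<?n}) (glue_edge t u)"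
      by (rule connected_graph_image[OF con]) simp
    show "connected_graph (glue_map ?r u ` gV u) (Inr ` {..<length (gE u)}) (glue_edge t u)"
      by (rule connected_graph_image[OF wf_gm_connected[OF u]]) simp
    show "Inl ` gV t \<inter> glue_map ?r u ` gV u = {Inl ?r}"
      using u r by (auto simp: glue_map_def wf_gm_def image_iff split: if_splits)
    show "circuit (glue_edge t u) (Inl ` P)"
      by (rule circuit_map[OF P(2), of "gV t" Inl]) (use ein P(1) in \<open>auto simp: edges_in_def\<close>)
  qed (use P(1) in auto)
  have diff: "Inl ` {..<?n} - Inl ` P = (Inl ` ({..<?n} - P) :: (nat + nat) set)" by auto
  have full: "inj_functional \<kappa> t u = sep_sum \<kappa> (Inl ` gV t) (Inl ` gV t \<union> glue_map ?r u ` gV u)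
      (Inl ` {..<?n} \<union> Inr ` {..<length (gE u)}) (glue_edge t u)" for u
    by (simp add: inj_functional_def glue_verts_def glue_indices_def)
  have endsC: "ends (glue_edge t u) (Inl ` P) \<inter>
      component (Inl ` gV t) (Inl ` {..<?n} - Inl ` P) (glue_edge t u) (Inl ?r) = Inl ` (ends ?e P \<inter> C)" for u
    unfolding diff component_glue_Inl ends_glue_Inl C_def[symmetric] by auto
  show ?thesis
  proof (cases "\<exists>w. ends ?e P \<inter> C = {w}")
    case True
    then obtain w where w: "ends ?e P \<inter> C = {w}" ..
    \<comment> \<open>The cycle and everything hanging off it away from the root, without any
      quotient. This weight can vanish, for instance if two vertices of the cycle are also linked
      off it in the removed part.\<close>
    define c where "c = weight \<kappa> (gV t - C \<union> {w}) ({..<?n} - K) ?e"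
    have "inj_functional \<kappa> t u = c * inj_functional \<kappa> t' u" if u: "wf_gm u" for u
    proof -
      let ?X = "glue_map ?r u ` gV u" and ?J = "Inr ` {..<length (gE u)} :: (nat + nat) set"
      have "ends (glue_edge t u) (Inl ` P) \<inter>
          component (Inl ` gV t) (Inl ` {..<?n} - Inl ` P) (glue_edge t u) (Inl ?r) = {Inl w}"
        unfolding endsC w by simp
      from sep_sum_cut[OF glue[OF u] this]
      have "inj_functional \<kappa> t u =
          weight \<kappa> (Inl ` gV t - Inl ` C \<union> {Inl w}) (Inl ` {..<?n} - Inl ` K) (glue_edge t u) *
          sep_sum \<kappa> (Inl ` C) (Inl ` C \<union> ?X) (Inl ` K \<union> ?J) (glue_edge t u)"
        unfolding full diff component_glue_Inl component_edges_glue_Inl C_def[symmetric] K_def[symmetric] .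
      also have "weight \<kappa> (Inl ` gV t - Inl ` C \<union> {Inl w}) (Inl ` {..<?n} - Inl ` K) (glue_edge t u) = c"
        unfolding c_def
      proof (rule weight_iso[where h = Inl and f = Inl])
        show "edges_in (gV t - C \<union> {w}) ({..<?n} - K) ?e"
          using edges_in_component_complement[OF ein w[unfolded C_def]] unfolding C_def K_def .
        show "bij_betw Inl ({..<?n} - K) (Inl ` {..<?n} - Inl ` K)" by (auto simp: bij_betw_def)
      qed auto
      also have "sep_sum \<kappa> (Inl ` C) (Inl ` C \<union> ?X) (Inl ` K \<union> ?J) (glue_edge t u) = inj_functional \<kappa> t' u"
      proof -
        let ?V = "glue_verts t' u"
        \<comment> \<open>Sends the position of an edge in \<open>t'\<close> to its position in
          \<open>t\<close> and leaves the edges of \<open>u\<close> alone.\<close>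
        define h :: "nat + nat \<Rightarrow> nat + nat" where "h = map_sum ((!) (sorted_list_of_set K)) (\<lambda>j. j)"
        have b: "bij_betw ((!) (sorted_list_of_set K)) {..<card K} K" by (rule bij_sorted_list_of_set[OF finK])
        have I: "glue_indices t' u = Inl ` {..<card K} \<union> ?J"
          using finK by (simp add: glue_indices_def t'_def)
        have hI: "bij_betw h (glue_indices t' u) (Inl ` K \<union> ?J)"
          unfolding bij_betw_def
        proof
          have "(!) (sorted_list_of_set K) ` {..<card K} = K" using b by (simp add: bij_betw_def)
          then show "h ` glue_indices t' u = Inl ` K \<union> ?J"
            unfolding I image_Un h_def by (simp add: image_image) (metis image_image)
          show "inj_on h (glue_indices t' u)"
            unfolding I h_def using b by (auto simp: inj_on_def bij_betw_def)
        qed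
        have d: "glue_edge t u (h j) = relabel id (glue_edge t' u j)" if "j \<in> glue_indices t' u" for j
          using that finK unfolding I by (auto simp: h_def t'_def)
        have V: "?V = Inl ` C \<union> ?X" by (simp add: glue_verts_def t'_def)
        have "sep_sum \<kappa> (id ` Inl ` gV t') (id ` ?V) (Inl ` K \<union> ?J) (glue_edge t u) = inj_functional \<kappa> t' u"
        proof -
          have set_eq: "{(x, y). x \<in> Inl ` gV t' \<and> y \<in> Inl ` gV t' \<and> id x = id y} = Id_on (Inl ` gV t')"
            by auto
          have "Inl ` gV t' \<subseteq> ?V" by (auto simp: glue_verts_def)
          from sep_sum_pullback[OF hI d edges_in_glue[OF wf' u] this]
          show ?thesis unfolding set_eq inj_functional_def sep_sum_def[of _ _ ?V] by simp
        qed
        then show ?thesis unfolding V by (simp add: t'_def)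
      qed
      finally show ?thesis .
    qed
    then show ?thesis using wf' len crd by (intro exI[of _ c] exI[of _ t']) (auto simp: t'_def)
  next
    case False
    \<comment> \<open>Two vertices of the cycle lie in the root component, so the functional is
      zero. With constant 0 any smaller monomial is a valid witness, and \<open>t'\<close> is
      reused.\<close>
    then obtain x y where xy: "x \<in> ends ?e P \<inter> C" "y \<in> ends ?e P \<inter> C" "x \<noteq> y" using ne by blast
    have "inj_functional \<kappa> t u = 0" if u: "wf_gm u" for u
      unfolding full
      by (rule sep_sum_eq_0[OF glue[OF u], of "Inl x" "Inl y"], unfold endsC) (use xy in auto)
    then show ?thesis using wf' len crd by (intro exI[of _ 0] exI[of _ t']) (auto simp: t'_def)
  qed
qed

text \<open>Two elements are congruent modulo \<psi> once they induce the same functional on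
  monomials \<open>u\<close>, so the class of functionals coming from tree combinations is the
  target. It is closed under linear combinations.\<close>

definition tree_functional :: "('a gmon \<Rightarrow> complex) \<Rightarrow> bool" where
  "tree_functional F \<longleftrightarrow> (\<exists>T\<in>Delta_tree_span. \<forall>u. wf_gm u \<longrightarrow>
     F u = (\<Sum>(c, g)\<leftarrow>T. c * psi_gm \<kappa> (gmul g u)))"

lemma tree_functional_cong:
  "tree_functional F \<Longrightarrow> (\<And>u. wf_gm u \<Longrightarrow> G u = F u) \<Longrightarrow> tree_functional G"
proof -
  assume F: "tree_functional F" and eq: "\<And>u. wf_gm u \<Longrightarrow> G u = F u"
  obtain T where "T \<in> Delta_tree_span" "\<forall>u. wf_gm u \<longrightarrow> F u = (\<Sum>(c, g)\<leftarrow>T. c * psi_gm \<kappa> (gmul g u))"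
    using F by (auto simp: tree_functional_def)
  then show "tree_functional G" unfolding tree_functional_def by (intro bexI[of _ T]) (auto simp: eq)
qed

lemma tree_functional_0: "tree_functional (\<lambda>u. 0)"
  unfolding tree_functional_def by (rule bexI[of _ "[]"]) (auto simp: Delta_tree_span_def)

lemma tree_functional_tree:
  "wf_gm t \<Longrightarrow> gin t = gout t \<Longrightarrow> is_tree (gV t) (gE t) \<Longrightarrow> tree_functional (\<lambda>u. psi_gm \<kappa> (gmul t u))"
  unfolding tree_functional_def by (rule bexI[of _ "[(1, t)]"]) (auto simp: Delta_tree_span_def)

lemma tree_functional_add:
  assumes "tree_functional F" "tree_functional G"
  shows "tree_functional (\<lambda>u. F u + G u)"
proof -
  obtain S T where "S \<in> Delta_tree_span" "\<forall>u. wf_gm u \<longrightarrow> F u = (\<Sum>(c, g)\<leftarrow>S. c * psi_gm \<kappa> (gmul g u))"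
    "T \<in> Delta_tree_span" "\<forall>u. wf_gm u \<longrightarrow> G u = (\<Sum>(c, g)\<leftarrow>T. c * psi_gm \<kappa> (gmul g u))"
    using assms by (auto simp: tree_functional_def)
  then show ?thesis
    unfolding tree_functional_def by (intro bexI[of _ "S @ T"]) (auto simp: Delta_tree_span_def)
qed

lemma tree_functional_scale:
  assumes "tree_functional F"
  shows "tree_functional (\<lambda>u. a * F u)"
proof -
  obtain T where T: "T \<in> Delta_tree_span" "\<forall>u. wf_gm u \<longrightarrow> F u = (\<Sum>(c, g)\<leftarrow>T. c * psi_gm \<kappa> (gmul g u))"
    using assms by (auto simp: tree_functional_def)
  have "(\<Sum>(c, g)\<leftarrow>map (\<lambda>(c, g). (a * c, g)) S. c * f g) = a * (\<Sum>(c, g)\<leftarrow>S. c * f g)"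
    for S and f :: "'a gmon \<Rightarrow> complex"
    by (induction S) (auto simp: algebra_simps)
  then show ?thesis
    using T unfolding tree_functional_def
    by (intro bexI[of _ "map (\<lambda>(c, g). (a * c, g)) T"]) (auto simp: Delta_tree_span_def)
qed

lemma tree_functional_sum:
  assumes "finite A" "\<And>x. x \<in> A \<Longrightarrow> tree_functional (F x)"
  shows "tree_functional (\<lambda>u. \<Sum>x\<in>A. F x u)"
  using assms
  by (induction A rule: finite_induct) (auto intro: tree_functional_0 tree_functional_add)

text \<open>The sum of edges and vertices is a common measure for both moves. A proper quotient of a
  tree keeps its edges and loses vertices, though it may create cycles; removing a cycle loses edges
  and gains no vertices.\<close>

lemma tree_functional_inj:
  assumes "wf_gm t" "gin t = gout t"
  shows "tree_functional (inj_functional \<kappa> t)"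
  using assms
proof (induction "length (gE t) + card (gV t)" arbitrary: t rule: less_induct)
  case (less t)
  note t = less.prems
  show ?case
  proof (cases "is_tree (gV t) (gE t)")
    case True
    let ?Id = "Id_on (gV t)" and ?A = "eqrels (gV t)"
    have Id: "?Id \<in> ?A" by (rule eqrelsI) auto
    have fin: "finite ?A" using finite_eqrels wf_gm_finite[OF t(1)] .
    have "tree_functional (inj_functional \<kappa> (quot_gm t \<rho>))" if "\<rho> \<in> ?A - {?Id}" for \<rho>
      using less.hyps[of "quot_gm t \<rho>"] card_quot_gm_less[of t \<rho>] that wf_gm_finite[OF t(1)]
        wf_quot_gm[OF t(1)] t(2) by simp
    then have "tree_functional (\<lambda>u. psi_gm \<kappa> (gmul t u) +
        (- 1) * (\<Sum>\<rho>\<in>?A - {?Id}. inj_functional \<kappa> (quot_gm t \<rho>) u))"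
      using t True fin
      by (intro tree_functional_add tree_functional_scale tree_functional_sum tree_functional_tree) auto
    then show ?thesis
      by (rule tree_functional_cong)
         \<comment> \<open>The discrete relation contributes the functional of \<open>t\<close>
           itself, so subtracting the other terms isolates it.\<close>
         (simp add: psi_gm_gmul_sum[OF t] sum.remove[OF fin Id] quot_gm_Id[OF t(1)])
  next
    case False
    then obtain P where "P \<subseteq> {..<length (gE t)}" "circuit ((!) (gE t)) P"
      using t by (auto simp: is_tree_def wf_gm_def is_scycle_iff_circuit)
    then obtain c t' where t': "wf_gm t'" "gin t' = gout t'" "length (gE t') < length (gE t)"
      "card (gV t') \<le> card (gV t)" "\<And>u. wf_gm u \<Longrightarrow> inj_functional \<kappa> t u = c * inj_functional \<kappa> t' u"
      using inj_functional_remove_circuit[OF t] by blast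
    have "tree_functional (inj_functional \<kappa> t')" using less.hyps t' by simp
    then show ?thesis using tree_functional_cong[OF tree_functional_scale] t'(5) by blast
  qed
qed

lemma tree_functional_psi:
  assumes t: "wf_gm t" "gin t = gout t"
  shows "tree_functional (\<lambda>u. psi_gm \<kappa> (gmul t u))"
proof (rule tree_functional_cong)
  show "tree_functional (\<lambda>u. \<Sum>\<rho>\<in>eqrels (gV t). inj_functional \<kappa> (quot_gm t \<rho>) u)"
    by (intro tree_functional_sum tree_functional_inj finite_eqrels wf_gm_finite wf_quot_gm t) (simp add: t)
qed (rule psi_gm_gmul_sum[OF t])

lemma tree_functional_comb:
  assumes "t \<in> Delta_span"
  shows "tree_functional (\<lambda>u. \<Sum>(c, g)\<leftarrow>t. c * psi_gm \<kappa> (gmul g u))"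
  using assms
proof (induction t)
  case Nil
  then show ?case by (simp add: tree_functional_0)
next
  case (Cons x t)
  obtain c g where x: "x = (c, g)" by (cases x)
  have "tree_functional (\<lambda>u. \<Sum>(c, g)\<leftarrow>t. c * psi_gm \<kappa> (gmul g u))"
    using Cons by (auto simp: Delta_span_def)
  moreover have "tree_functional (\<lambda>u. c * psi_gm \<kappa> (gmul g u))"
    using Cons.prems x by (intro tree_functional_scale tree_functional_psi) (auto simp: Delta_span_def)
  ultimately show ?case using x tree_functional_add by simp
qed

end

section \<open>From monomials to linear combinations\<close>

lemma psi_append: "psi \<kappa> (x @ y) = psi \<kappa> x + psi \<kappa> y"
  by (simp add: psi_def)

lemma psi_cmul_single: "psi \<kappa> (map (\<lambda>(d, h). (c * d, gmul g h)) u) = c * (\<Sum>(d, h)\<leftarrow>u. d * psi_gm \<kappa> (gmul g h))"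
  by (induction u) (auto simp: psi_def algebra_simps)

text \<open>Putting the sum over \<open>u\<close> outside leaves inside the functional of
  \<open>x\<close> evaluated at a single monomial, the form in which tree representatives are
  compared with \<open>x\<close>.\<close>

lemma psi_cmul:
  "psi \<kappa> (cmul x u) = (\<Sum>(d, h)\<leftarrow>u. d * (\<Sum>(c, g)\<leftarrow>x. c * psi_gm \<kappa> (gmul g h)))"
proof (induction x)
  case Nil
  have "(\<Sum>(d, h)\<leftarrow>u. d * (0 :: complex)) = 0" by (induction u) auto
  then show ?case by (simp add: cmul_def psi_def)
next
  case (Cons a x)
  obtain c g where a: "a = (c, g)" by (cases a)
  have "psi \<kappa> (cmul (a # x) u) = psi \<kappa> (map (\<lambda>(d, h). (c * d, gmul g h)) u) + psi \<kappa> (cmul x u)"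
    by (simp add: cmul_def a psi_append[symmetric])
  also have "\<dots> = c * (\<Sum>(d, h)\<leftarrow>u. d * psi_gm \<kappa> (gmul g h)) +
      (\<Sum>(d, h)\<leftarrow>u. d * (\<Sum>(c, g)\<leftarrow>x. c * psi_gm \<kappa> (gmul g h)))"
    by (simp only: psi_cmul_single Cons.IH)
  also have "\<dots> = (\<Sum>(d, h)\<leftarrow>u. d * (\<Sum>(c, g)\<leftarrow>a # x. c * psi_gm \<kappa> (gmul g h)))"
    by (induction u) (auto simp: a algebra_simps)
  finally show ?case .
qed

lemma sum_cdiff:
  "(\<Sum>(c, g)\<leftarrow>cdiff x y. c * f g) = (\<Sum>(c, g)\<leftarrow>x. c * f g) - (\<Sum>(c, g)\<leftarrow>y. c * (f g :: complex))"
  by (induction y) (auto simp: cdiff_def algebra_simps)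

theorem theorem1p23:
  fixes smul :: "complex \<Rightarrow> 'a::ring_1 \<Rightarrow> 'a"
    and \<phi> :: "'a \<Rightarrow> complex"
    and \<kappa> :: "'a list \<Rightarrow> complex"
  assumes "complex_algebra smul"
    and "\<forall>a b. \<phi> (a + b) = \<phi> a + \<phi> b"
    and "\<forall>c a. \<phi> (smul c a) = c * \<phi> a"
    and "\<phi> 1 = 1"
    and "\<forall>a b. \<phi> (a * b) = \<phi> (b * a)"
    and "free_cumulants \<phi> \<kappa>"
  shows "\<forall>t\<in>Delta_span. \<exists>T\<in>Delta_tree_span. equiv_mod_psi \<kappa> T t"
proof
  fix t :: "'a gcomb" assume t: "t \<in> Delta_span"
  interpret cyclic_cumulants \<kappa>
    by unfold_locales (rule cumulant_rotate[OF assms(5,6)])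
  obtain T where T: "T \<in> Delta_tree_span" and
    eq: "\<And>u. wf_gm u \<Longrightarrow> (\<Sum>(c, g)\<leftarrow>t. c * psi_gm \<kappa> (gmul g u)) = (\<Sum>(c, g)\<leftarrow>T. c * psi_gm \<kappa> (gmul g u))"
    using tree_functional_comb[OF t] unfolding tree_functional_def by blast
  have "psi \<kappa> (cmul (cdiff T t) u) = 0" if "u \<in> B_span" for u
    unfolding psi_cmul sum_cdiff
  proof -
    have "\<forall>(d, h)\<in>set u. wf_gm h" using that by (simp add: B_span_def)
    then show "(\<Sum>(d, h)\<leftarrow>u. d * ((\<Sum>(c, g)\<leftarrow>T. c * psi_gm \<kappa> (gmul g h)) -
        (\<Sum>(c, g)\<leftarrow>t. c * psi_gm \<kappa> (gmul g h)))) = 0"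
      by (induction u) (auto simp: eq)
  qed
  then show "\<exists>T\<in>Delta_tree_span. equiv_mod_psi \<kappa> T t"
    using T unfolding equiv_mod_psi_def by blast
qed

end
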